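(* There exists an absolute constant $\eta>0$ with the following property. Let $\delta>0$ and let $l$ be a positive integer. Then for every sufficiently large perfect square $n$ (in terms of $\delta$ and $l$), the subsets $A=\{v\in\mathbb F_2^n:|v|\le n/2-10^{20}n^{3/4}\}$ and $B=\{v\in\mathbb F_2^n:|v|=n^{1/2}\}$ of $G=\mathbb F_2^n$ are such that $A$ is $(B,\eta)$-closed, but there do not exist a non-empty set $C\subset A+lB$ and a set $B'\subset B$ with $|B'|\ge\delta|B|$ such that $C$ is $(B',0.99)$-closed. Consequently the following statement is false: for every $\eta,\epsilon>0$ there exist $c>0$, $\delta>0$ and a positive integer $l$ such that, whenever $G$ is a finite Abelian group and $A,B\subset G$ are subsets such that $A$ is $(B,\eta)$-closed, there are a subset $B'\subset B$ and a non-empty subset $C\subset G$ with (1) $|B'|\ge\delta|B|$; (2) $C$ is $(B',1-\epsilon)$-closed; (3) for every $x\in C$, the probability that $x-b_1-\dots-b_l+b_{l+1}+\dots+b_{2l}\in A$, when $b_1,\dots,b_{2l}$ are chosen uniformly and independently at random from $B$, is at least $c$.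
   Context: For $v\in\mathbb F_2^n$, $|v|$ is the number of entries of $v$ equal to 1. $A+lB$ is the set of all sums $a+b_1+\dots+b_l$ with $a\in A$ and $b_1,\dots,b_l\in B$. For finite non-empty subsets $A,B$ of an Abelian group, $A$ is $(B,\eta)$-closed if $|\{(a,b)\in A\times B:a+b\in A\}|\ge\eta|A||B|$. *)

theory Defs
  imports
    "HOL-Algebra.FiniteProduct"
    "HOL-Algebra.Product_Groups"
    "HOL-Probability.Product_PMF"
begin

text \<open>
  All groups are HOL-Algebra groups, hence written multiplicatively: \<open>a \<otimes>\<^bsub>G\<^esub> b\<close> is \<open>a + b\<close>.
\<close>

definition F2 :: "nat \<Rightarrow> (nat \<Rightarrow> int) monoid" where
  "F2 n = product_group {..<n} (\<lambda>_. integer_mod_group 2)"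

definition weight :: "nat \<Rightarrow> (nat \<Rightarrow> int) \<Rightarrow> nat" where
  "weight n v = card {i \<in> {..<n}. v i = 1}"

definition almost_closed :: "'a monoid \<Rightarrow> 'a set \<Rightarrow> real \<Rightarrow> 'a set \<Rightarrow> bool" where
  "almost_closed G B \<eta> A \<longleftrightarrow>
     A \<subseteq> carrier G \<and> finite A \<and> A \<noteq> {} \<and>
     B \<subseteq> carrier G \<and> finite B \<and> B \<noteq> {} \<and>
     real (card {(a, b) \<in> A \<times> B. a \<otimes>\<^bsub>G\<^esub> b \<in> A}) \<ge> \<eta> * real (card A) * real (card B)"

definition sumset_iter :: "'a monoid \<Rightarrow> 'a set \<Rightarrow> nat \<Rightarrow> 'a set \<Rightarrow> 'a set" where
  "sumset_iter G A l B =
     {a \<otimes>\<^bsub>G\<^esub> finprod G b {1..l} | a b. a \<in> A \<and> b \<in> {1..l} \<rightarrow> B}"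

text \<open>
  The probability that \<open>x - b\<^sub>1 - \<dots> - b\<^sub>l + b\<^sub>l\<^sub>+\<^sub>1 + \<dots> + b\<^sub>2\<^sub>l\<close> lies in \<open>A\<close> for independent
  uniform elements \<open>b\<^sub>i\<close> of \<open>B\<close>; meaningful for finite non-empty \<open>B\<close> only, since
  \<^const>\<open>pmf_of_set\<close> is unspecified otherwise.  The second argument of \<^const>\<open>Pi_pmf\<close> is the
  irrelevant value at indices outside \<open>{1..2 * l}\<close>.
\<close>

definition walk_prob :: "'a monoid \<Rightarrow> 'a set \<Rightarrow> 'a set \<Rightarrow> nat \<Rightarrow> 'a \<Rightarrow> real" where
  "walk_prob G A B l x =
     measure_pmf.prob (Pi_pmf {1..2 * l} undefined (\<lambda>_. pmf_of_set B))
       {b. x \<otimes>\<^bsub>G\<^esub> inv\<^bsub>G\<^esub> (finprod G b {1..l}) \<otimes>\<^bsub>G\<^esub> finprod G b {l+1..2 * l} \<in> A}"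

text \<open>
  Since every finite group is isomorphic to one whose carrier is a set of natural numbers, letting
  \<open>G\<close> range over \<^typ>\<open>nat monoid\<close> covers all finite Abelian groups.
\<close>

definition closed_subset_property :: bool where
  "closed_subset_property \<longleftrightarrow>
     (\<forall>\<eta>>0. \<forall>\<epsilon>>0. \<exists>c>0. \<exists>\<delta>>0. \<exists>l::nat. l > 0 \<and>
        (\<forall>(G :: nat monoid) A B.
           comm_group G \<and> finite (carrier G) \<and> almost_closed G B \<eta> A \<longrightarrow>
           (\<exists>B' C. B' \<subseteq> B \<and> C \<subseteq> carrier G \<and> C \<noteq> {} \<and>
              real (card B') \<ge> \<delta> * real (card B) \<and>
              almost_closed G B' (1 - \<epsilon>) C \<and>
              (\<forall>x\<in>C. walk_prob G A B l x \<ge> c))))"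

lemma comm_group_F2: "comm_group (F2 n)"
proof (rule group.group_comm_groupI)
  show "group (F2 n)"
    unfolding F2_def by (rule product_group) simp
qed (auto simp: F2_def add.commute)

lemma card_carrier_F2: "card (carrier (F2 n)) = 2 ^ n"
  by (simp add: F2_def card_PiE carrier_integer_mod_group)

end

theory Submission
  imports Defs "HOL-Real_Asymp.Real_Asymp"
begin

text \<open>
  Let \<open>n = m\<^sup>2\<close>, \<open>K = 10\<^sup>2\<^sup>0\<close>, and encode a vector by its support \<open>x\<close> or by the signs \<open>X\<^sub>i\<close>, negative
  exactly on \<open>x\<close>.  Adding \<open>b\<close> flips the signs on \<open>b\<close> and changes the weight by the sum of \<open>X\<^sub>i\<close> over \<open>b\<close>.

  For \<open>x\<close> near the boundary of \<open>A\<close> and random \<open>b\<close> in \<open>B\<close> this sum has mean of order \<open>K \<surd>m\<close> and standard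
  deviation of order \<open>\<surd>m\<close>, so it is non-positive with probability bounded below; hence \<open>A\<close> is closed.

  Now let \<open>C\<close> be closed under a dense \<open>B'\<close>.  The map \<open>(x, b) \<mapsto> (x + b, b)\<close> is an involution on the pairs
  with \<open>x\<close> and \<open>x + b\<close> in \<open>C\<close>.  It has two consequences.  First, a step from a point with
  \<open>\<langle>X, Y\<rangle> \<ge> \<epsilon> n\<close> decreases \<open>\<langle>X, Y\<rangle>\<close> up to exponentially small probability, so by reversal almost no
  step staying in \<open>C\<close> starts at such a point; therefore most points of \<open>C\<close> are nearly orthogonal to any
  boundedly many given vectors \<open>Y\<close>.  Second, at least half of the steps staying in \<open>C\<close> do not increase
  the weight.  So one can pick many pairwise nearly orthogonal \<open>X\<^sub>1, \<dots>, X\<^sub>R\<close> in \<open>C\<close> such that each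
  of the events \<open>\<Sum>\<^sub>i\<^sub>\<in>\<^sub>b (X\<^sub>j)\<^sub>i \<le> 0\<close> has probability about one half for \<open>b\<close> in \<open>B'\<close>; hence for a positive
  proportion of \<open>b\<close> in \<open>B'\<close> a fixed proportion of the events hold together.  But for \<open>b\<close> uniform in \<open>B\<close>
  any \<open>q\<close> of them hold together with probability at most \<open>2 exp (- K\<^sup>2 q / 8)\<close>, because near
  orthogonality makes the sum of the \<open>X\<^sub>j\<close> small in \<open>L\<^sup>2\<close> compared with its mean.  Taking \<open>R\<close> large in
  terms of the density of \<open>B'\<close> gives a contradiction.

  The closed subset property fails because in a group of exponent 2 a positive walk probability at \<open>x\<close>
  with \<open>2l\<close> steps places \<open>x\<close> in \<open>A + 2lB\<close>.
\<close>

section \<open>Exponential tail bounds on the slice\<close>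

definition slice :: "nat \<Rightarrow> nat set set" where
  "slice m = {b. b \<subseteq> {..<m\<^sup>2} \<and> card b = m}"

lemma finite_slice [simp]: "finite (slice m)"
  unfolding slice_def by simp

lemma card_slice: "card (slice m) = (m\<^sup>2 choose m)"
  unfolding slice_def using n_subsets[of "{..<m\<^sup>2}" m] by simp

lemma card_slice_pos: "card (slice m) > 0"
  unfolding card_slice by (rule zero_less_binomial) (simp add: power2_eq_square)

text \<open>The left side consists of the first two terms of the binomial expansion. This is the
  inductive step of \<open>fact_mult_esym_le\<close>.\<close>

lemma power_Suc_add_ge:
  fixes s y :: real
  assumes "s \<ge> 0" "y \<ge> 0"
  shows "s ^ Suc k + real (Suc k) * y * s ^ k \<le> (y + s) ^ Suc k"
proof (induction k)
  case (Suc k)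
  have "s ^ Suc (Suc k) + real (Suc (Suc k)) * y * s ^ Suc k
      \<le> (y + s) * (s ^ Suc k + real (Suc k) * y * s ^ k)"
    using assms by (simp add: algebra_simps)
  also have "\<dots> \<le> (y + s) * (y + s) ^ Suc k"
    by (intro mult_left_mono Suc) (use assms in auto)
  finally show ?case by simp
qed simp

text \<open>In the expansion of the power, every square-free monomial of degree \<open>k\<close>
  occurs \<open>fact k\<close> times and all other terms are non-negative. The induction splits the
  elementary symmetric polynomial according to whether \<open>b\<close> contains the new
  element.\<close>

lemma fact_mult_esym_le:
  fixes y :: "'a \<Rightarrow> real"
  assumes "finite N" "\<And>i. i \<in> N \<Longrightarrow> 0 \<le> y i"
  shows "fact k * (\<Sum>b | b \<subseteq> N \<and> card b = k. \<Prod>i\<in>b. y i) \<le> (\<Sum>i\<in>N. y i) ^ k"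
  using assms
proof (induction N arbitrary: k rule: finite_induct)
  case empty
  have "{b. b \<subseteq> ({}::'a set) \<and> card b = k} = (if k = 0 then {{}} else {})" by auto
  then show ?case by simp
next
  case (insert a N)
  show ?case
  proof (cases k)
    case 0
    have "{b. b \<subseteq> insert a N \<and> card b = 0} = {{}}"
      using insert.hyps by (auto dest: finite_subset)
    then show ?thesis using 0 by simp
  next
    case (Suc k')
    let ?E = "\<lambda>j. \<Sum>b | b \<subseteq> N \<and> card b = j. \<Prod>i\<in>b. y i"
    let ?S = "\<Sum>i\<in>N. y i"
    have fin: "finite b" if "b \<subseteq> N" for b using that insert.hyps finite_subset by blast
    have split: "{b. b \<subseteq> insert a N \<and> card b = Suc k'}
        = {b. b \<subseteq> N \<and> card b = Suc k'} \<union> insert a ` {b. b \<subseteq> N \<and> card b = k'}" (is "?L = ?R1 \<union> ?R2")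
    proof (intro equalityI subsetI)
      fix b assume b: "b \<in> ?L"
      show "b \<in> ?R1 \<union> ?R2"
      proof (cases "a \<in> b")
        case True
        then have "b = insert a (b - {a})" by auto
        moreover have "b - {a} \<subseteq> N" "card (b - {a}) = k'" using b True by auto
        ultimately show ?thesis by blast
      qed (use b in auto)
    next
      fix b assume "b \<in> ?R1 \<union> ?R2"
      then show "b \<in> ?L" using insert.hyps fin by (auto simp: card_insert_if)
    qed
    have "(\<Sum>b\<in>?L. \<Prod>i\<in>b. y i) = ?E (Suc k') + (\<Sum>b\<in>?R2. \<Prod>i\<in>b. y i)"
      unfolding split by (rule sum.union_disjoint) (use insert.hyps in auto)
    also have "(\<Sum>b\<in>?R2. \<Prod>i\<in>b. y i) = (\<Sum>b | b \<subseteq> N \<and> card b = k'. \<Prod>i\<in>insert a b. y i)"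
    proof (subst sum.reindex)
      show "inj_on (insert a) {b. b \<subseteq> N \<and> card b = k'}"
        using insert.hyps by (auto simp: inj_on_def)
    qed simp
    also have "\<dots> = y a * ?E k'"
      unfolding sum_distrib_left
      by (intro sum.cong refl prod.insert) (use insert.hyps fin in auto)
    finally have "fact k * (\<Sum>b\<in>?L. \<Prod>i\<in>b. y i)
        = fact (Suc k') * ?E (Suc k') + real (Suc k') * y a * (fact k' * ?E k')"
      by (simp add: Suc algebra_simps)
    also have "\<dots> \<le> ?S ^ Suc k' + real (Suc k') * y a * ?S ^ k'"
      by (intro add_mono mult_left_mono insert.IH) (use insert.prems in auto)
    also have "\<dots> \<le> (y a + ?S) ^ Suc k'"
      by (rule power_Suc_add_ge) (use insert.prems in \<open>auto intro: sum_nonneg\<close>)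
    finally show ?thesis using insert.hyps by (simp add: Suc)
  qed
qed

text \<open>
  Up to the factor 2, a uniform \<open>m\<close>-subset of \<open>m\<^sup>2\<close> points behaves like \<open>m\<close> independent points,
  because the latter are distinct with probability at least one half.
\<close>

lemma power_le_card_slice:
  assumes "m \<ge> 1"
  shows "real (m\<^sup>2) ^ m \<le> 2 * (fact m * real (card (slice m)))"
proof -
  let ?n = "real (m\<^sup>2)"
  have n: "?n > 0" using assms by simp
  have lt: "i \<le> m\<^sup>2" if "i < m" for i
    using mult_le_mono[of i m 1 m] that assms by (simp add: power2_eq_square)
  have "fact m * real (card (slice m)) = (\<Prod>i = 0..<m. ?n - real i)"
    unfolding card_slice binomial_gbinomial gbinomial_prod_rev by simp
  also have "\<dots> = (\<Prod>i = 0..<m. ?n * (1 - real i / ?n))"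
    using n by (intro prod.cong refl) (simp add: field_simps)
  also have "\<dots> = ?n ^ m * (\<Prod>i = 0..<m. 1 - real i / ?n)"
    by (simp add: prod.distrib)
  also have "\<dots> \<ge> ?n ^ m * (1 - (\<Sum>i = 0..<m. real i / ?n))"
  proof (intro mult_left_mono Weierstrass_prod_ineq)
    fix i assume "i \<in> {0..<m}"
    then have "real i \<le> ?n" using lt[of i] by (simp only: of_nat_le_iff) simp
    then show "real i / ?n \<in> {0..1}" using n by (auto simp: divide_simps)
  qed simp_all
  \<comment> \<open>The sum equals \<open>m (m - 1) / (2 m^2)\<close>; it is a union bound for a
    collision among \<open>m\<close> independent points.\<close>
  moreover have "(\<Sum>i = 0..<m. real i / ?n) \<le> 1 / 2"
  proof -
    have "2 * (\<Sum>i = 0..<m. real i) = real m * (real m - 1)"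
      by (induction m) (auto simp: algebra_simps)
    then have "2 * (\<Sum>i = 0..<m. real i) \<le> ?n"
      by (simp add: power2_eq_square algebra_simps)
    then show ?thesis using n by (simp add: sum_divide_distrib[symmetric] field_simps)
  qed
  then have "?n ^ m * (1 - (\<Sum>i = 0..<m. real i / ?n)) \<ge> ?n ^ m * (1 / 2)"
    by (intro mult_left_mono) auto
  ultimately show ?thesis by linarith
qed

lemma exp_minus_le_quadratic:
  fixes z :: real
  assumes "\<bar>z\<bar> \<le> 1"
  shows "exp (- z) \<le> 1 - z + z\<^sup>2"
proof (cases "z \<le> 0")
  case True
  then show ?thesis using exp_bound[of "- z"] assms by simp
next
  case False
  \<comment> \<open>The product equals \<open>1 + z^3\<close>.\<close>
  have "1 \<le> (1 - z + z\<^sup>2) * (1 + z)"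
    using False by (simp add: algebra_simps power2_eq_square)
  also have "\<dots> \<le> (1 - z + z\<^sup>2) * exp z"
    using assms by (intro mult_left_mono exp_ge_add_one_self) auto
  finally show ?thesis by (simp add: exp_minus field_simps)
qed

text \<open>Chernoff's method: on the event, the exponential of \<open>- lam\<close> times the sum
  of \<open>V\<close> over \<open>b\<close> is at least 1. Summed over the slice, these exponentials
  form an elementary symmetric polynomial, which \<open>fact_mult_esym_le\<close> and
  \<open>power_le_card_slice\<close> compare with the case of independent points. The parameter
  \<open>lam\<close> stays free; each application takes \<open>\<mu> / (2 * \<nu>)\<close>, which
  minimises the exponent.\<close>

lemma slice_tail:
  fixes V :: "nat \<Rightarrow> real"
  assumes m: "m \<ge> 1" and lam: "lam \<ge> 0"
    and bdd: "\<And>i. i < m\<^sup>2 \<Longrightarrow> \<bar>lam * V i\<bar> \<le> 1"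
    and mean: "(\<Sum>i<m\<^sup>2. V i) \<ge> (real m)\<^sup>2 * \<mu>"
    and var: "(\<Sum>i<m\<^sup>2. (V i)\<^sup>2) \<le> (real m)\<^sup>2 * \<nu>"
  shows "real (card {b \<in> slice m. (\<Sum>i\<in>b. V i) \<le> 0})
     \<le> 2 * real (card (slice m)) * exp (real m * (lam\<^sup>2 * \<nu> - lam * \<mu>))"
proof -
  let ?y = "\<lambda>i. exp (- (lam * V i))" and ?n = "(real m)\<^sup>2"
  have n: "?n > 0" using m by simp
  have fin: "finite b" if "b \<in> slice m" for b
    using that unfolding slice_def using finite_subset by blast
  have "real (card {b \<in> slice m. (\<Sum>i\<in>b. V i) \<le> 0}) = (\<Sum>b \<in> {b \<in> slice m. (\<Sum>i\<in>b. V i) \<le> 0}. 1)"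
    by simp
  also have "\<dots> \<le> (\<Sum>b \<in> {b \<in> slice m. (\<Sum>i\<in>b. V i) \<le> 0}. \<Prod>i\<in>b. ?y i)"
  proof (rule sum_mono)
    fix b assume b: "b \<in> {b \<in> slice m. (\<Sum>i\<in>b. V i) \<le> 0}"
    then have "(\<Prod>i\<in>b. ?y i) = exp (- (lam * (\<Sum>i\<in>b. V i)))"
      using fin by (simp add: exp_sum[symmetric] sum_distrib_left sum_negf)
    then show "1 \<le> (\<Prod>i\<in>b. ?y i)"
      using b lam by (simp add: mult_nonneg_nonpos)
  qed
  also have "\<dots> \<le> (\<Sum>b \<in> slice m. \<Prod>i\<in>b. ?y i)"
    by (intro sum_mono2) (auto intro: prod_nonneg)
  finally have 1: "real (card {b \<in> slice m. (\<Sum>i\<in>b. V i) \<le> 0}) \<le> (\<Sum>b \<in> slice m. \<Prod>i\<in>b. ?y i)" .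
  have "(\<Sum>i<m\<^sup>2. ?y i) \<le> (\<Sum>i<m\<^sup>2. 1 - lam * V i + (lam * V i)\<^sup>2)"
    by (intro sum_mono exp_minus_le_quadratic bdd) auto
  also have "\<dots> = ?n - lam * (\<Sum>i<m\<^sup>2. V i) + lam\<^sup>2 * (\<Sum>i<m\<^sup>2. (V i)\<^sup>2)"
    by (simp add: sum.distrib sum_subtractf sum_distrib_left power_mult_distrib)
  also have "\<dots> \<le> ?n - lam * (?n * \<mu>) + lam\<^sup>2 * (?n * \<nu>)"
    using mean var lam by (intro add_mono diff_mono mult_left_mono) auto
  also have "\<dots> = ?n * (1 + (lam\<^sup>2 * \<nu> - lam * \<mu>))" by (simp add: algebra_simps)
  also have "\<dots> \<le> ?n * exp (lam\<^sup>2 * \<nu> - lam * \<mu>)"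
    by (intro mult_left_mono exp_ge_add_one_self) auto
  finally have 2: "(\<Sum>i<m\<^sup>2. ?y i) \<le> ?n * exp (lam\<^sup>2 * \<nu> - lam * \<mu>)" .
  have "fact m * (\<Sum>b \<in> slice m. \<Prod>i\<in>b. ?y i) \<le> (\<Sum>i<m\<^sup>2. ?y i) ^ m"
    unfolding slice_def by (rule fact_mult_esym_le) auto
  also have "\<dots> \<le> (?n * exp (lam\<^sup>2 * \<nu> - lam * \<mu>)) ^ m"
    by (intro power_mono 2 sum_nonneg) auto
  also have "\<dots> = ?n ^ m * exp (real m * (lam\<^sup>2 * \<nu> - lam * \<mu>))"
    by (simp only: power_mult_distrib exp_of_nat_mult)
  also have "\<dots> \<le> 2 * (fact m * real (card (slice m))) * exp (real m * (lam\<^sup>2 * \<nu> - lam * \<mu>))"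
    using power_le_card_slice[OF m] by (intro mult_right_mono) auto
  finally have "fact m * (\<Sum>b \<in> slice m. \<Prod>i\<in>b. ?y i)
      \<le> fact m * (2 * real (card (slice m)) * exp (real m * (lam\<^sup>2 * \<nu> - lam * \<mu>)))"
    by (simp add: mult_ac)
  then have "(\<Sum>b \<in> slice m. \<Prod>i\<in>b. ?y i)
      \<le> 2 * real (card (slice m)) * exp (real m * (lam\<^sup>2 * \<nu> - lam * \<mu>))"
    by (rule mult_left_le_imp_le) simp
  then show ?thesis using 1 by linarith
qed

section \<open>Steps that stay in a set\<close>

definition sg :: "nat set \<Rightarrow> nat \<Rightarrow> real" where
  "sg x i = (if i \<in> x then - 1 else 1)"

lemma sg_mult_self [simp]: "sg x i * sg x i = 1"
  by (simp add: sg_def)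

lemma abs_sg [simp]: "\<bar>sg x i\<bar> = 1"
  by (simp add: sg_def)

lemma sg_mult_le_1: "sg x i * sg y i \<le> 1"
  by (simp add: sg_def)

definition sd :: "nat set \<Rightarrow> nat set \<Rightarrow> nat set" where
  "sd x b = sym_diff x b"

lemma sd_sd [simp]: "sd (sd x b) b = x"
  by (auto simp: sd_def)

lemma sg_sd: "sg (sd x b) i = (if i \<in> b then - sg x i else sg x i)"
  by (auto simp: sg_def sd_def)

lemma sum_sg_sd:
  assumes "finite N" "b \<subseteq> N"
  shows "(\<Sum>i\<in>N. sg (sd x b) i * Y i) = (\<Sum>i\<in>N. sg x i * Y i) - 2 * (\<Sum>i\<in>b. sg x i * Y i)"
proof -
  have "(\<Sum>i\<in>N. sg (sd x b) i * Y i)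
      = (\<Sum>i\<in>N. sg x i * Y i - 2 * (if i \<in> b then sg x i * Y i else 0))"
    by (intro sum.cong refl) (auto simp: sg_sd)
  also have "\<dots> = (\<Sum>i\<in>N. sg x i * Y i) - 2 * (\<Sum>i\<in>N. if i \<in> b then sg x i * Y i else 0)"
    by (simp add: sum_subtractf sum_distrib_left)
  also have "(\<Sum>i\<in>N. if i \<in> b then sg x i * Y i else 0) = (\<Sum>i\<in>b. sg x i * Y i)"
    using assms by (simp add: sum.inter_restrict[symmetric] Int_absorb1)
  finally show ?thesis .
qed

lemma sum_sg_sd_self:
  "(\<Sum>i\<in>b. sg (sd x b) i * Y i) = - (\<Sum>i\<in>b. sg x i * Y i)"
  by (simp add: sum_negf[symmetric] sg_sd)

text \<open>These are the pairs counted in \<open>almost_closed\<close>, with vectors replaced by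
  their supports.\<close>

definition stay :: "nat set set \<Rightarrow> nat set set \<Rightarrow> (nat set \<times> nat set) set" where
  "stay C B = {(x, b) \<in> C \<times> B. sd x b \<in> C}"

definition flip :: "nat set \<times> nat set \<Rightarrow> nat set \<times> nat set" where
  "flip = (\<lambda>(x, b). (sd x b, b))"

lemma flip_flip [simp]: "flip (flip p) = p"
  by (auto simp: flip_def split: prod.split)

lemma inj_on_flip: "inj_on flip A"
  by (metis flip_flip inj_onI)

lemma finite_stay: "finite C \<Longrightarrow> finite B \<Longrightarrow> finite (stay C B)"
  unfolding stay_def by (rule finite_subset[of _ "C \<times> B"]) auto

lemma card_pairs:
  assumes "finite C" "finite B"
  shows "card {(x, b) \<in> C \<times> B. Q x b} = (\<Sum>x\<in>C. card {b \<in> B. Q x b})"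
proof -
  have "{(x, b) \<in> C \<times> B. Q x b} = (SIGMA x:C. {b \<in> B. Q x b})" by auto
  then show ?thesis using assms by simp
qed

text \<open>Reversing a step by \<open>flip\<close> negates the weight change, so a step or its
  reverse does not increase the weight.\<close>

lemma card_stay_le_double:
  assumes "finite C" "finite B"
  shows "card (stay C B) \<le> 2 * card {(x, b) \<in> stay C B. (\<Sum>i\<in>b. sg x i) \<le> 0}"
proof -
  let ?T = "{(x, b) \<in> stay C B. (\<Sum>i\<in>b. sg x i) \<le> 0}"
  have fin: "finite ?T"
    by (rule finite_subset[OF _ finite_stay[OF assms]]) auto
  have "stay C B \<subseteq> ?T \<union> flip ` ?T"
  proof
    fix p assume p: "p \<in> stay C B"
    obtain x b where xb: "p = (x, b)" by fastforce
    show "p \<in> ?T \<union> flip ` ?T"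
    proof (cases "(\<Sum>i\<in>b. sg x i) \<le> 0")
      case False
      have "(\<Sum>i\<in>b. sg (sd x b) i) = - (\<Sum>i\<in>b. sg x i)"
        using sum_sg_sd_self[of x b "\<lambda>_. 1"] by simp
      then have "(\<Sum>i\<in>b. sg (sd x b) i) \<le> 0" using False by linarith
      moreover have "(sd x b, b) \<in> stay C B" using p by (simp add: xb stay_def)
      ultimately have "flip p \<in> ?T" by (simp add: flip_def xb)
      then have "flip (flip p) \<in> flip ` ?T" by (rule imageI)
      then show ?thesis by (simp only: flip_flip Un_iff simp_thms)
    qed (use p xb in auto)
  qed
  then have "card (stay C B) \<le> card (?T \<union> flip ` ?T)"
    using fin by (intro card_mono) auto
  also have "\<dots> \<le> card ?T + card (flip ` ?T)" by (rule card_Un_le)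
  also have "card (flip ` ?T) = card ?T" by (rule card_image[OF inj_on_flip])
  finally show ?thesis by simp
qed

text \<open>Let a step start at correlation at least \<open>\<theta> + 2 m\<close> with
  \<open>y\<close>. If its sum over \<open>b\<close> is non-positive, the step is rare by
  \<open>drift\<close>. Otherwise the correlation drops by at most \<open>2 m\<close>, because
  \<open>b\<close> has \<open>m\<close> elements, so the reversed step starts at correlation at
  least \<open>\<theta>\<close> with a negative sum and is rare as well. The two cases give the
  factor 2.\<close>

lemma card_stay_drift_le:
  fixes \<tau> \<theta> :: real
  assumes fin: "finite C" and B: "B \<subseteq> slice m"
    and drift: "\<And>x. x \<in> C \<Longrightarrow> (\<Sum>i<m\<^sup>2. sg x i * sg y i) \<ge> \<theta> \<Longrightarrow>
      real (card {b \<in> B. (\<Sum>i\<in>b. sg x i * sg y i) \<le> 0}) \<le> \<tau> * real (card B)"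
    and "\<tau> \<ge> 0"
  shows "real (card {(x, b) \<in> stay C B. (\<Sum>i<m\<^sup>2. sg x i * sg y i) \<ge> \<theta> + 2 * real m})
      \<le> 2 * \<tau> * real (card C) * real (card B)" (is "real (card ?S) \<le> _")
proof -
  let ?Q = "\<lambda>x b. (\<Sum>i<m\<^sup>2. sg x i * sg y i) \<ge> \<theta> \<and> (\<Sum>i\<in>b. sg x i * sg y i) \<le> 0"
  let ?T = "{(x, b) \<in> C \<times> B. ?Q x b}"
  have finB: "finite B" using B finite_slice finite_subset by blast
  have finT: "finite ?T"
    by (rule finite_subset[of _ "C \<times> B"]) (use fin finB in auto)
  have "?S \<subseteq> ?T \<union> flip ` ?T"
  proof
    fix p assume p: "p \<in> ?S"
    obtain x b where xb: "p = (x, b)" by fastforce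
    have b: "b \<subseteq> {..<m\<^sup>2}" "card b = m" using p B xb by (auto simp: stay_def slice_def)
    have sm: "(\<Sum>i\<in>b. sg x i * sg y i) \<le> real m"
      using sum_bounded_above[of b "\<lambda>i. sg x i * sg y i" 1] b sg_mult_le_1 by simp
    show "p \<in> ?T \<union> flip ` ?T"
    proof (cases "(\<Sum>i\<in>b. sg x i * sg y i) \<le> 0")
      case True
      then show ?thesis using p xb by (auto simp: stay_def)
    next
      case False
      have "(\<Sum>i<m\<^sup>2. sg x i * sg y i) \<ge> \<theta> + 2 * real m" using p xb by simp
      then have "?Q (sd x b) b"
        using sum_sg_sd[of "{..<m\<^sup>2}" b x "sg y"] sum_sg_sd_self[where x=x and b=b and Y="sg y"] b(1) False sm
        by simp
      moreover have "(sd x b, b) \<in> C \<times> B" using p by (simp add: xb stay_def)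
      ultimately have "flip p \<in> ?T" by (simp add: flip_def xb)
      then have "flip (flip p) \<in> flip ` ?T" by (rule imageI)
      then show ?thesis by (simp only: flip_flip Un_iff simp_thms)
    qed
  qed
  then have "card ?S \<le> card (?T \<union> flip ` ?T)"
    using finT by (intro card_mono) auto
  also have "\<dots> \<le> card ?T + card (flip ` ?T)" by (rule card_Un_le)
  also have "card (flip ` ?T) = card ?T" by (rule card_image[OF inj_on_flip])
  finally have "real (card ?S) \<le> 2 * real (card ?T)" by linarith
  also have "real (card ?T) = (\<Sum>x\<in>C. real (card {b \<in> B. ?Q x b}))"
    unfolding card_pairs[OF fin finB] by simp
  also have "\<dots> \<le> (\<Sum>x\<in>C. \<tau> * real (card B))"
  proof (rule sum_mono)
    fix x assume x: "x \<in> C"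
    show "real (card {b \<in> B. ?Q x b}) \<le> \<tau> * real (card B)"
    proof (cases "(\<Sum>i<m\<^sup>2. sg x i * sg y i) \<ge> \<theta>")
      case True
      then show ?thesis using drift[OF x True] by simp
    qed (use \<open>\<tau> \<ge> 0\<close> in simp)
  qed
  finally show ?thesis by (simp add: mult_ac)
qed

text \<open>An averaging argument over \<open>C \<times> B\<close>: by
  \<open>card_stay_le_double\<close>, at least 49.5 percent of the pairs are staying steps that do
  not increase the weight, and at most 0.4 percent start at a point too correlated with some
  \<open>X j\<close>. Hence some remaining point has at least 49 percent of \<open>B\<close> as
  non-increasing directions.\<close>

lemma exists_almost_orthogonal:
  fixes e t :: real
  assumes fin: "finite C" "finite B" and ne: "C \<noteq> {}" "B \<noteq> {}"
    and closed: "real (card (stay C B)) \<ge> 99/100 * real (card C) * real (card B)"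
    and few: "\<And>j. j < k \<Longrightarrow>
      real (card {(x, b) \<in> stay C B. (\<Sum>i\<in>N. sg x i * sg (X j) i) \<ge> e}) \<le> t * real (card C) * real (card B)"
    and kt: "real k * t \<le> 1/250"
  obtains x where "x \<in> C" "\<And>j. j < k \<Longrightarrow> (\<Sum>i\<in>N. sg x i * sg (X j) i) < e"
    "real (card {b \<in> B. (\<Sum>i\<in>b. sg x i) \<le> 0}) \<ge> 49/100 * real (card B)"
proof (rule ccontr)
  assume not: "\<not> thesis"
  let ?cb = "real (card C) * real (card B)"
  let ?S = "\<lambda>j. {(x, b) \<in> stay C B. (\<Sum>i\<in>N. sg x i * sg (X j) i) \<ge> e}"
  let ?good = "\<lambda>x. \<forall>j<k. (\<Sum>i\<in>N. sg x i * sg (X j) i) < e"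
  let ?G = "{(x, b) \<in> C \<times> B. ?good x \<and> (\<Sum>i\<in>b. sg x i) \<le> 0}"
  let ?T = "{(x, b) \<in> stay C B. (\<Sum>i\<in>b. sg x i) \<le> 0}"
  have pos: "?cb > 0" using fin ne by (simp add: card_gt_0_iff)
  have finS: "finite (?S j)" for j
    by (rule finite_subset[OF _ finite_stay[OF fin]]) auto
  have finG: "finite ?G"
    by (rule finite_subset[of _ "C \<times> B"]) (use fin in auto)
  have "?T \<subseteq> (\<Union>j<k. ?S j) \<union> ?G"
    by (auto simp: stay_def not_less)
  then have "card ?T \<le> card ((\<Union>j<k. ?S j) \<union> ?G)"
    using finS finG by (intro card_mono) auto
  also have "\<dots> \<le> card (\<Union>j<k. ?S j) + card ?G" by (rule card_Un_le)
  also have "\<dots> \<le> (\<Sum>j<k. card (?S j)) + card ?G"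
    by (intro add_mono card_UN_le) auto
  finally have T: "real (card ?T) \<le> (\<Sum>j<k. real (card (?S j))) + real (card ?G)"
    unfolding of_nat_sum[symmetric] of_nat_add[symmetric] of_nat_le_iff .
  have "(\<Sum>j<k. real (card (?S j))) \<le> (\<Sum>j<k. t * ?cb)"
    by (intro sum_mono) (use few in \<open>auto simp: mult.assoc\<close>)
  also have "\<dots> = real k * t * ?cb" by simp
  also have "\<dots> \<le> 1/250 * ?cb" using pos kt by (intro mult_right_mono) auto
  finally have S: "(\<Sum>j<k. real (card (?S j))) \<le> 1/250 * ?cb" .
  have "real (card ?G) = (\<Sum>x\<in>C. real (card {b \<in> B. ?good x \<and> (\<Sum>i\<in>b. sg x i) \<le> 0}))"
    unfolding card_pairs[OF fin] by simp
  also have "\<dots> \<le> (\<Sum>x\<in>C. 49/100 * real (card B))"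
  proof (rule sum_mono)
    fix x assume x: "x \<in> C"
    show "real (card {b \<in> B. ?good x \<and> (\<Sum>i\<in>b. sg x i) \<le> 0}) \<le> 49/100 * real (card B)"
    proof (cases "?good x")
      case True
      have "{b \<in> B. ?good x \<and> (\<Sum>i\<in>b. sg x i) \<le> 0} = {b \<in> B. (\<Sum>i\<in>b. sg x i) \<le> 0}"
        using True by blast
      moreover have "real (card {b \<in> B. (\<Sum>i\<in>b. sg x i) \<le> 0}) < 49/100 * real (card B)"
        using not that[OF x] True by (meson not_le)
      ultimately show ?thesis by (simp only: less_imp_le)
    next
      case False
      then have E: "{b \<in> B. ?good x \<and> (\<Sum>i\<in>b. sg x i) \<le> 0} = {}" by blast
      show ?thesis unfolding E by simp
    qed
  qed
  also have "\<dots> = 49/100 * ?cb" by simp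
  \<comment> \<open>\<open>247/500\<close> is \<open>49/100 + 1/250\<close>, which lies below
    \<open>99/200\<close>, the half of \<open>99/100\<close>.\<close>
  finally have "real (card ?T) \<le> 247/500 * ?cb" using T S by linarith
  moreover have "real (card (stay C B)) \<le> 2 * real (card ?T)"
    using card_stay_le_double[OF fin] by linarith
  moreover have "real (card (stay C B)) \<ge> 99/100 * ?cb"
    using closed by (simp only: mult.assoc)
  ultimately show False using pos by linarith
qed

text \<open>Greedy choice: \<open>exists_almost_orthogonal\<close> supplies each new point, nearly
  orthogonal to all earlier ones.\<close>

lemma exists_almost_orthogonal_family:
  fixes e t :: real
  assumes fin: "finite C" "finite B" and ne: "C \<noteq> {}" "B \<noteq> {}"
    and closed: "real (card (stay C B)) \<ge> 99/100 * real (card C) * real (card B)"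
    and few: "\<And>y. y \<in> C \<Longrightarrow>
      real (card {(x, b) \<in> stay C B. (\<Sum>i\<in>N. sg x i * sg y i) \<ge> e}) \<le> t * real (card C) * real (card B)"
    and t: "real k * t \<le> 1/250" "t \<ge> 0"
  shows "\<exists>X. (\<forall>j<k. X j \<in> C \<and> real (card {b \<in> B. (\<Sum>i\<in>b. sg (X j) i) \<le> 0}) \<ge> 49/100 * real (card B))
    \<and> (\<forall>j<k. \<forall>j'<k. j \<noteq> j' \<longrightarrow> (\<Sum>i\<in>N. sg (X j) i * sg (X j') i) \<le> e)"
  using t(1)
proof (induction k)
  case (Suc k)
  have kt: "real k * t \<le> 1/250"
    using Suc.prems t(2) by (simp add: algebra_simps)
  then obtain X where X: "\<And>j. j < k \<Longrightarrow> X j \<in> C"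
      "\<And>j. j < k \<Longrightarrow> real (card {b \<in> B. (\<Sum>i\<in>b. sg (X j) i) \<le> 0}) \<ge> 49/100 * real (card B)"
      "\<And>j j'. j < k \<Longrightarrow> j' < k \<Longrightarrow> j \<noteq> j' \<Longrightarrow> (\<Sum>i\<in>N. sg (X j) i * sg (X j') i) \<le> e"
    using Suc.IH by blast
  obtain x where x: "x \<in> C" "\<And>j. j < k \<Longrightarrow> (\<Sum>i\<in>N. sg x i * sg (X j) i) < e"
    "real (card {b \<in> B. (\<Sum>i\<in>b. sg x i) \<le> 0}) \<ge> 49/100 * real (card B)"
    by (rule exists_almost_orthogonal[OF fin ne closed few[OF X(1)] kt]) auto
  have x': "(\<Sum>i\<in>N. sg (X j) i * sg x i) \<le> e" if "j < k" for j
    using x(2)[OF that] by (simp add: mult.commute)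
  have x'': "(\<Sum>i\<in>N. sg x i * sg (X j) i) \<le> e" if "j < k" for j
    using x(2)[OF that] by simp
  show ?case
  proof (intro exI[of _ "X(k := x)"] conjI allI impI)
    fix j assume "j < Suc k"
    then show "(X(k := x)) j \<in> C" using X(1)[of j] x(1) by (cases "j = k") auto
  next
    fix j assume "j < Suc k"
    then show "real (card {b \<in> B. (\<Sum>i\<in>b. sg ((X(k := x)) j) i) \<le> 0}) \<ge> 49/100 * real (card B)"
      using X(2)[of j] x(3) by (cases "j = k") auto
  next
    fix j j' assume "j < Suc k" "j' < Suc k" "j \<noteq> j'"
    then show "(\<Sum>i\<in>N. sg ((X(k := x)) j) i * sg ((X(k := x)) j') i) \<le> e"
      using X(3)[of j j'] x'[of j] x''[of j'] by (cases "j = k"; cases "j' = k") auto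
  qed
qed simp

section \<open>No dense set of directions preserves a set of low weight\<close>

text \<open>Double counting shows that at least 29 percent of \<open>B\<close> satisfies at least
  \<open>R / 5\<close> of the events. A union bound over the at most \<open>2 ^ R\<close> index sets
  \<open>J\<close> then bounds the number of these elements.\<close>

lemma count_events:
  fixes p :: real
  assumes fin: "finite B"
    and ev: "\<And>j. j < R \<Longrightarrow> real (card {b \<in> B. E j b}) \<ge> 49/100 * real (card B)"
    and J: "\<And>J. J \<subseteq> {..<R} \<Longrightarrow> real (card J) \<ge> 1/5 * real R \<Longrightarrow>
      real (card {b \<in> B. \<forall>j\<in>J. E j b}) \<le> p" and "p \<ge> 0" "R \<ge> 1"
  shows "29/100 * real (card B) \<le> 2 ^ R * p"
proof -
  let ?N = "\<lambda>b. {j. j < R \<and> E j b}"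
  let ?H = "{b \<in> B. real (card (?N b)) \<ge> 1/5 * real R}"
  let ?Js = "{J. J \<subseteq> {..<R} \<and> real (card J) \<ge> 1/5 * real R}"
  have finJs: "finite ?Js" by (rule finite_subset[of _ "Pow {..<R}"]) auto
  have "49/100 * real R * real (card B) = (\<Sum>j<R. 49/100 * real (card B))" by simp
  also have "\<dots> \<le> (\<Sum>j<R. real (card {b \<in> B. E j b}))"
    using ev by (intro sum_mono) auto
  also have "\<dots> = (\<Sum>j<R. \<Sum>b\<in>B. if E j b then 1 else 0)"
    using fin by (simp add: sum.If_cases Int_def)
  also have "\<dots> = (\<Sum>b\<in>B. \<Sum>j<R. if E j b then 1 else 0)" by (rule sum.swap)
  also have "\<dots> = (\<Sum>b\<in>B. real (card (?N b)))"
    by (simp add: sum.If_cases Int_def)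
  \<comment> \<open>An element outside \<open>?H\<close> satisfies fewer than \<open>R / 5\<close>
    events and one inside at most \<open>R\<close>; this leaves
    \<open>49/100 - 1/5 = 29/100\<close>.\<close>
  also have "\<dots> \<le> (\<Sum>b\<in>B. 1/5 * real R + (if b \<in> ?H then real R else 0))"
  proof (rule sum_mono)
    fix b assume "b \<in> B"
    have "card (?N b) \<le> card {..<R}" by (rule card_mono) auto
    then show "real (card (?N b)) \<le> 1/5 * real R + (if b \<in> ?H then real R else 0)"
      using \<open>b \<in> B\<close> by auto
  qed
  also have "\<dots> = 1/5 * real R * real (card B) + real R * real (card ?H)"
  proof -
    have "(\<Sum>b\<in>B. if b \<in> ?H then real R else 0) = real R * real (card ?H)"
    proof -
      have H: "B \<inter> ?H = ?H" by blast
      show ?thesis unfolding sum.inter_restrict[OF fin, symmetric] H by simp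
    qed
    then show ?thesis by (simp add: sum.distrib)
  qed
  finally have "real R * (29/100 * real (card B)) \<le> real R * real (card ?H)"
    by (simp add: algebra_simps)
  then have "29/100 * real (card B) \<le> real (card ?H)"
    using \<open>R \<ge> 1\<close> by simp
  also have "card ?H \<le> card (\<Union>J\<in>?Js. {b \<in> B. \<forall>j\<in>J. E j b})"
  proof (rule card_mono)
    show "finite (\<Union>J\<in>?Js. {b \<in> B. \<forall>j\<in>J. E j b})" using finJs fin by auto
    show "?H \<subseteq> (\<Union>J\<in>?Js. {b \<in> B. \<forall>j\<in>J. E j b})"
    proof
      fix b assume "b \<in> ?H"
      then show "b \<in> (\<Union>J\<in>?Js. {b \<in> B. \<forall>j\<in>J. E j b})"
        by (intro UN_I[of "?N b"]) auto
    qed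
  qed
  then have "real (card ?H) \<le> real (card (\<Union>J\<in>?Js. {b \<in> B. \<forall>j\<in>J. E j b}))" by simp
  also have "\<dots> \<le> (\<Sum>J\<in>?Js. real (card {b \<in> B. \<forall>j\<in>J. E j b}))"
    using card_UN_le[OF finJs, of "\<lambda>J. {b \<in> B. \<forall>j\<in>J. E j b}"]
    unfolding of_nat_sum[symmetric] of_nat_le_iff .
  also have "\<dots> \<le> (\<Sum>J\<in>?Js. p)" by (intro sum_mono J) auto
  also have "\<dots> = real (card ?Js) * p" by simp
  also have "\<dots> \<le> 2 ^ R * p"
  proof (rule mult_right_mono)
    have "card ?Js \<le> card (Pow {..<R})" by (rule card_mono) auto
    also have "\<dots> = 2 ^ R" by (simp add: card_Pow)
    finally show "real (card ?Js) \<le> 2 ^ R" by (simp flip: of_nat_le_iff)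
  qed fact
  finally show ?thesis by simp
qed

text \<open>If all events hold, the sum \<open>V\<close> of the sign vectors has non-positive sum
  over \<open>b\<close>, so \<open>slice_tail\<close> applies to \<open>V\<close>. The mean of
  \<open>V\<close> grows like \<open>q K / s\<close>. Near orthogonality bounds its second moment by
  a diagonal part \<open>q m^2\<close> plus \<open>q^2 m^2 / R\<close>, at most
  \<open>2 q m^2\<close> in total.\<close>

lemma card_joint_descent_le:
  fixes X :: "nat \<Rightarrow> nat set"
  assumes K: "K \<ge> 10" and m: "m \<ge> 1" "K * real R \<le> 4 * sqrt (real m)" and R: "R \<ge> 1"
    and J: "J \<subseteq> {..<R}" "real (card J) \<ge> 1/5 * real R"
    and mean: "\<And>j. j < R \<Longrightarrow> (\<Sum>i<m\<^sup>2. sg (X j) i) \<ge> K * real m * sqrt (real m)"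
    and orth: "\<And>j j'. j < R \<Longrightarrow> j' < R \<Longrightarrow> j \<noteq> j' \<Longrightarrow>
      (\<Sum>i<m\<^sup>2. sg (X j) i * sg (X j') i) \<le> (real m)\<^sup>2 / real R"
  shows "real (card {b \<in> slice m. \<forall>j\<in>J. (\<Sum>i\<in>b. sg (X j) i) \<le> 0})
    \<le> 2 * real (card (slice m)) * exp (- 2 * real R)"
proof -
  define q where "q = real (card J)"
  define s where "s = sqrt (real m)"
  have s: "s > 0" "s * s = real m" using m by (auto simp: s_def)
  have finJ: "finite J" using J finite_subset by blast
  have q: "1/5 * real R \<le> q" "q \<le> real R"
    using J card_mono[of "{..<R}" J] by (auto simp: q_def)
  have Rpos: "real R > 0" using R by simp
  define V where "V i = (\<Sum>j\<in>J. sg (X j) i)" for i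
  have Vle: "\<bar>V i\<bar> \<le> q" for i
    using sum_abs[of "\<lambda>j. sg (X j) i" J] by (simp add: V_def q_def)
  have sub: "{b \<in> slice m. \<forall>j\<in>J. (\<Sum>i\<in>b. sg (X j) i) \<le> 0} \<subseteq> {b \<in> slice m. (\<Sum>i\<in>b. V i) \<le> 0}"
  proof
    fix b assume b: "b \<in> {b \<in> slice m. \<forall>j\<in>J. (\<Sum>i\<in>b. sg (X j) i) \<le> 0}"
    have "(\<Sum>i\<in>b. V i) = (\<Sum>j\<in>J. \<Sum>i\<in>b. sg (X j) i)" unfolding V_def by (rule sum.swap)
    also have "\<dots> \<le> 0" by (rule sum_nonpos) (use b in simp)
    finally show "b \<in> {b \<in> slice m. (\<Sum>i\<in>b. V i) \<le> 0}" using b by simp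
  qed
  have "real (card {b \<in> slice m. \<forall>j\<in>J. (\<Sum>i\<in>b. sg (X j) i) \<le> 0})
      \<le> real (card {b \<in> slice m. (\<Sum>i\<in>b. V i) \<le> 0})"
    using sub by (intro of_nat_mono card_mono) auto
  \<comment> \<open>Here \<open>\<mu> = q K / s\<close> and \<open>\<nu> = 2 q\<close>, so
    \<open>lam = \<mu> / (2 \<nu>) = K / (4 s)\<close>. The assumption
    \<open>K * real R \<le> 4 * sqrt (real m)\<close> keeps \<open>lam * V i\<close> within
    \<open>[-1, 1]\<close>.\<close>
  also have "\<dots> \<le> 2 * real (card (slice m)) * exp (real m * ((K / (4 * s))\<^sup>2 * (2 * q) - K / (4 * s) * (q * K / s)))"
  proof (rule slice_tail)
    show "m \<ge> 1" by fact
    show "K / (4 * s) \<ge> 0" using K s by simp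
    fix i
    have "K * \<bar>V i\<bar> \<le> K * real R" using Vle[of i] q K by (intro mult_left_mono) auto
    also have "\<dots> \<le> 4 * s" using m by (simp add: s_def)
    finally show "\<bar>K / (4 * s) * V i\<bar> \<le> 1" using s K by (simp add: abs_mult)
  next
    have "(real m)\<^sup>2 * (q * K / s) = (\<Sum>j\<in>J. K * real m * s)"
      using s by (simp add: q_def field_simps power2_eq_square)
    also have "\<dots> \<le> (\<Sum>j\<in>J. \<Sum>i<m\<^sup>2. sg (X j) i)"
      unfolding s_def using J by (intro sum_mono mean) auto
    also have "\<dots> = (\<Sum>i<m\<^sup>2. V i)" unfolding V_def by (rule sum.swap)
    finally show "(\<Sum>i<m\<^sup>2. V i) \<ge> (real m)\<^sup>2 * (q * K / s)" .
  next
    have "(\<Sum>i<m\<^sup>2. (V i)\<^sup>2) = (\<Sum>i<m\<^sup>2. \<Sum>j\<in>J. \<Sum>j'\<in>J. sg (X j) i * sg (X j') i)"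
      unfolding V_def power2_eq_square sum_product ..
    also have "\<dots> = (\<Sum>j\<in>J. \<Sum>i<m\<^sup>2. \<Sum>j'\<in>J. sg (X j) i * sg (X j') i)" by (rule sum.swap)
    also have "\<dots> = (\<Sum>j\<in>J. \<Sum>j'\<in>J. \<Sum>i<m\<^sup>2. sg (X j) i * sg (X j') i)"
      by (intro sum.cong refl sum.swap)
    also have "\<dots> \<le> (\<Sum>j\<in>J. \<Sum>j'\<in>J. (if j = j' then (real m)\<^sup>2 else 0) + (real m)\<^sup>2 / real R)"
    proof (intro sum_mono)
      fix j j' assume "j \<in> J" "j' \<in> J"
      then have "j < R" "j' < R" using J by auto
      then show "(\<Sum>i<m\<^sup>2. sg (X j) i * sg (X j') i)
          \<le> (if j = j' then (real m)\<^sup>2 else 0) + (real m)\<^sup>2 / real R"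
        using orth[of j j'] by auto
    qed
    also have "\<dots> = q * (real m)\<^sup>2 + q * (q * ((real m)\<^sup>2 / real R))"
      using finJ by (simp add: sum.distrib q_def distrib_left)
    also have "\<dots> \<le> q * (real m)\<^sup>2 + q * (real m)\<^sup>2"
    proof (intro add_left_mono mult_left_mono)
      show "q * ((real m)\<^sup>2 / real R) \<le> (real m)\<^sup>2"
        using q Rpos by (simp add: field_simps mult_right_mono)
    qed (simp add: q_def)
    finally show "(\<Sum>i<m\<^sup>2. (V i)\<^sup>2) \<le> (real m)\<^sup>2 * (2 * q)" by (simp add: mult_ac)
  qed
  also have "real m * ((K / (4 * s))\<^sup>2 * (2 * q) - K / (4 * s) * (q * K / s)) = - (K * K * q / 8)"
    using s unfolding s(2)[symmetric] by (simp add: field_simps power2_eq_square)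
  \<comment> \<open>From \<open>K \<ge> 10\<close> and \<open>q \<ge> R / 5\<close> the exponent is
    even at most \<open>- 5/2 * R\<close>.\<close>
  also have "\<dots> \<le> - 2 * real R"
  proof -
    have "100 * (1/5 * real R) \<le> (K * K) * q"
      using K q mult_mono[of 10 K 10 K] by (intro mult_mono) auto
    then show ?thesis by simp
  qed
  finally show ?thesis by (simp add: mult_left_mono)
qed

text \<open>This is \<open>slice_tail\<close> with \<open>\<mu> = 1 / (2 R)\<close>,
  \<open>\<nu> = 1\<close> and \<open>lam = 1 / (4 R)\<close>; it supplies the hypothesis
  \<open>drift\<close> of \<open>card_stay_drift_le\<close>.\<close>

lemma card_low_drift_le:
  assumes R: "R \<ge> (1::nat)" and m: "m \<ge> 1"
    and mean: "(\<Sum>i<m\<^sup>2. sg x i * sg y i) \<ge> (real m)\<^sup>2 / (2 * real R)"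
  shows "real (card {b \<in> slice m. (\<Sum>i\<in>b. sg x i * sg y i) \<le> 0})
    \<le> 2 * real (card (slice m)) * exp (- real m / (16 * (real R)\<^sup>2))"
proof -
  have "real (card {b \<in> slice m. (\<Sum>i\<in>b. sg x i * sg y i) \<le> 0})
    \<le> 2 * real (card (slice m)) * exp (real m * ((1 / (4 * real R))\<^sup>2 * 1 - 1 / (4 * real R) * (1 / (2 * real R))))"
  proof (rule slice_tail)
    fix i
    show "\<bar>1 / (4 * real R) * (sg x i * sg y i)\<bar> \<le> 1"
      using R by (simp add: abs_mult)
  next
    have "(\<Sum>i<m\<^sup>2. (sg x i * sg y i)\<^sup>2) = (\<Sum>i<m\<^sup>2. 1)"
      by (intro sum.cong refl) (simp add: sg_def)
    then show "(\<Sum>i<m\<^sup>2. (sg x i * sg y i)\<^sup>2) \<le> (real m)\<^sup>2 * 1" by simp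
  qed (use m mean in auto)
  also have "real m * ((1 / (4 * real R))\<^sup>2 * 1 - 1 / (4 * real R) * (1 / (2 * real R)))
      = - real m / (16 * (real R)\<^sup>2)"
    using R by (simp add: field_simps power2_eq_square)
  finally show ?thesis .
qed

text \<open>If \<open>C\<close> were closed, \<open>R\<close> nearly orthogonal points of
  \<open>C\<close> would exist, and \<open>count_events\<close> combined with
  \<open>card_joint_descent_le\<close> would bound the density of \<open>B\<close> by a quantity
  that falls below \<open>\<delta>\<close> for suitable \<open>R\<close>.\<close>

theorem card_stay_less:
  assumes K: "K \<ge> (10::real)" and \<delta>: "\<delta> > 0"
  shows "\<exists>M. \<forall>m\<ge>M. \<forall>C B. C \<subseteq> Pow {..<m\<^sup>2} \<longrightarrow> C \<noteq> {} \<longrightarrow>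
    (\<forall>x\<in>C. (\<Sum>i<m\<^sup>2. sg x i) \<ge> K * real m * sqrt (real m)) \<longrightarrow>
    B \<subseteq> slice m \<longrightarrow> real (card B) \<ge> \<delta> * real (card (slice m)) \<longrightarrow>
    real (card (stay C B)) < 99/100 * real (card C) * real (card B)"
proof -
  \<comment> \<open>\<open>2 ^ R * (2 * exp (- 2 R))\<close> is at most
    \<open>2 * (1 / 2) ^ R = (1 / 2) ^ R0\<close>; taking \<open>R = Suc R0\<close> absorbs the
    factor 2.\<close>
  obtain R0 where R0: "(1 / 2) ^ R0 < 29/100 * \<delta>"
    using real_arch_pow_inv[of "29/100 * \<delta>" "1/2"] \<delta> by auto
  define R where "R = Suc R0"
  have R: "R \<ge> 1" by (simp add: R_def)
  have exp2: "exp (2::real) \<ge> 4"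
    using power_mono[OF exp_ge_add_one_self[of 1], of 2] by (simp add: exp_of_nat_mult[symmetric])
  have Rp: "2 ^ R * (2 * exp (- 2 * real R)) < 29/100 * \<delta>"
  proof -
    have "exp (- 2 * real R) = exp (- 2) ^ R"
      by (simp add: exp_of_nat_mult[symmetric] mult.commute)
    also have "\<dots> \<le> (1 / 4) ^ R"
      using exp2 by (intro power_mono) (auto simp: exp_minus field_simps)
    finally have "2 ^ R * (2 * exp (- 2 * real R)) \<le> 2 ^ R * (2 * (1 / 4) ^ R)" by simp
    also have "\<dots> = 2 * (1 / 2) ^ R"
      by (simp add: power_mult_distrib[symmetric])
    also have "\<dots> < 29/100 * \<delta>" using R0 by (simp add: R_def)
    finally show ?thesis .
  qed
  \<comment> \<open>The bound of \<open>card_low_drift_le\<close> relative to \<open>B\<close>: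
    passing from the slice to a subset of density \<open>\<delta>\<close> costs
    \<open>1 / \<delta>\<close>.\<close>
  define \<tau> where "\<tau> m = 2 / \<delta> * exp (- real m / (16 * (real R)\<^sup>2))" for m
  \<comment> \<open>Three requirements on \<open>m\<close> follow: this one for the greedy choice,
    the second for \<open>card_joint_descent_le\<close>, the third for the drift threshold.\<close>
  have "\<forall>\<^sub>F m in sequentially. real R * (2 * \<tau> m) \<le> 1/250"
  proof -
    define c where "c = 1 / (16 * (real R)\<^sup>2)"
    have "c > 0" using R by (simp add: c_def)
    then have "(\<lambda>m. exp (- (c * real m))) \<longlonglongrightarrow> 0" by real_asymp
    then have "(\<lambda>m. real R * (2 * (2 / \<delta> * exp (- (c * real m))))) \<longlonglongrightarrow> real R * (2 * (2 / \<delta> * 0))"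
      by (intro tendsto_intros)
    then have "\<forall>\<^sub>F m in sequentially. real R * (2 * (2 / \<delta> * exp (- (c * real m)))) < 1/250"
      by (rule order_tendstoD) simp
    then show ?thesis
      by eventually_elim (simp add: \<tau>_def c_def)
  qed
  moreover have "\<forall>\<^sub>F m in sequentially. K * real R \<le> 4 * sqrt (real m)" by real_asymp
  moreover have "\<forall>\<^sub>F m in sequentially. m \<ge> 4 * R" by (rule eventually_ge_at_top)
  ultimately have "\<forall>\<^sub>F m in sequentially.
      real R * (2 * \<tau> m) \<le> 1/250 \<and> K * real R \<le> 4 * sqrt (real m) \<and> m \<ge> 4 * R"
    by eventually_elim blast
  then obtain M where M: "\<And>m. m \<ge> M \<Longrightarrow> real R * (2 * \<tau> m) \<le> 1/250"
      "\<And>m. m \<ge> M \<Longrightarrow> K * real R \<le> 4 * sqrt (real m)" "\<And>m. m \<ge> M \<Longrightarrow> m \<ge> 4 * R"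
    unfolding eventually_sequentially by blast
  show ?thesis
  proof (intro exI[of _ M] allI impI)
    fix m C B
    assume mM: "m \<ge> M" and C: "C \<subseteq> Pow {..<m\<^sup>2}" "C \<noteq> {}"
      and mean: "\<forall>x\<in>C. (\<Sum>i<m\<^sup>2. sg x i) \<ge> K * real m * sqrt (real m)"
      and B: "B \<subseteq> slice m" "real (card B) \<ge> \<delta> * real (card (slice m))"
    have m: "m \<ge> 1" using M(3)[OF mM] R by linarith
    have finC: "finite C" using C finite_subset by blast
    have finB: "finite B" using B finite_subset finite_slice by blast
    have Bpos: "card B > 0"
    proof -
      have "0 < \<delta> * real (card (slice m))" using \<delta> card_slice_pos[of m] by simp
      then show ?thesis using B(2) by linarith
    qed
    then have Bne: "B \<noteq> {}" by auto
    have \<tau>: "\<tau> m \<ge> 0" using \<delta> by (simp add: \<tau>_def)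
    have slice_le: "real (card (slice m)) \<le> real (card B) / \<delta>"
      using B(2) \<delta> by (simp add: field_simps)
    let ?e = "(real m)\<^sup>2 / real R"
    show "real (card (stay C B)) < 99/100 * real (card C) * real (card B)"
    proof (rule ccontr)
      assume "\<not> ?thesis"
      then have closed: "real (card (stay C B)) \<ge> 99/100 * real (card C) * real (card B)" by simp
      have few: "real (card {(x, b) \<in> stay C B. (\<Sum>i<m\<^sup>2. sg x i * sg y i) \<ge> ?e})
          \<le> 2 * \<tau> m * real (card C) * real (card B)" for y
      proof -
        \<comment> \<open>The threshold is written in the form required by
          \<open>card_stay_drift_le\<close>; \<open>m \<ge> 4 * R\<close> keeps
          \<open>?e - 2 m\<close> above half of \<open>?e\<close>.\<close>
        have "real (card {(x, b) \<in> stay C B. (\<Sum>i<m\<^sup>2. sg x i * sg y i) \<ge> (?e - 2 * real m) + 2 * real m})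
          \<le> 2 * \<tau> m * real (card C) * real (card B)"
        proof (rule card_stay_drift_le[OF finC B(1) _ \<tau>])
          fix x assume x: "(\<Sum>i<m\<^sup>2. sg x i * sg y i) \<ge> ?e - 2 * real m"
          have "4 * real R * real m \<le> real m * real m"
            using M(3)[OF mM] by (intro mult_right_mono) (auto simp flip: of_nat_mult)
          then have "?e - 2 * real m \<ge> (real m)\<^sup>2 / (2 * real R)"
            using R by (simp add: field_simps power2_eq_square)
          with x have "(\<Sum>i<m\<^sup>2. sg x i * sg y i) \<ge> (real m)\<^sup>2 / (2 * real R)" by linarith
          note card_low_drift_le[OF R m this]
          also have "2 * real (card (slice m)) * exp (- real m / (16 * (real R)\<^sup>2))
              \<le> 2 * (real (card B) / \<delta>) * exp (- real m / (16 * (real R)\<^sup>2))"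
            by (intro mult_right_mono mult_left_mono slice_le) auto
          also have "\<dots> = \<tau> m * real (card B)" by (simp add: \<tau>_def)
          finally have *: "real (card {b \<in> slice m. (\<Sum>i\<in>b. sg x i * sg y i) \<le> 0}) \<le> \<tau> m * real (card B)" .
          have "card {b \<in> B. (\<Sum>i\<in>b. sg x i * sg y i) \<le> 0} \<le> card {b \<in> slice m. (\<Sum>i\<in>b. sg x i * sg y i) \<le> 0}"
            using B(1) by (intro card_mono) auto
          then show "real (card {b \<in> B. (\<Sum>i\<in>b. sg x i * sg y i) \<le> 0}) \<le> \<tau> m * real (card B)"
            using * by linarith
        qed
        then show ?thesis by simp
      qed
      obtain X where X: "\<And>j. j < R \<Longrightarrow> X j \<in> C"
          "\<And>j. j < R \<Longrightarrow> real (card {b \<in> B. (\<Sum>i\<in>b. sg (X j) i) \<le> 0}) \<ge> 49/100 * real (card B)"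
          "\<And>j j'. j < R \<Longrightarrow> j' < R \<Longrightarrow> j \<noteq> j' \<Longrightarrow> (\<Sum>i<m\<^sup>2. sg (X j) i * sg (X j') i) \<le> ?e"
        using exists_almost_orthogonal_family[OF finC finB C(2) Bne closed few M(1)[OF mM]] \<tau> by auto
      have "29/100 * real (card B) \<le> 2 ^ R * (2 * real (card (slice m)) * exp (- 2 * real R))"
      proof (rule count_events[OF finB X(2)])
        fix J assume J: "J \<subseteq> {..<R}" "real (card J) \<ge> 1/5 * real R"
        have "card {b \<in> B. \<forall>j\<in>J. (\<Sum>i\<in>b. sg (X j) i) \<le> 0}
            \<le> card {b \<in> slice m. \<forall>j\<in>J. (\<Sum>i\<in>b. sg (X j) i) \<le> 0}"
          using B(1) by (intro card_mono) auto
        moreover have "real (card {b \<in> slice m. \<forall>j\<in>J. (\<Sum>i\<in>b. sg (X j) i) \<le> 0})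
            \<le> 2 * real (card (slice m)) * exp (- 2 * real R)"
          by (rule card_joint_descent_le[OF K m M(2)[OF mM] R J]) (use mean X in auto)
        ultimately show "real (card {b \<in> B. \<forall>j\<in>J. (\<Sum>i\<in>b. sg (X j) i) \<le> 0})
            \<le> 2 * real (card (slice m)) * exp (- 2 * real R)" by linarith
      qed (use R in auto)
      also have "\<dots> = real (card (slice m)) * (2 ^ R * (2 * exp (- 2 * real R)))" by simp
      also have "\<dots> < real (card (slice m)) * (29/100 * \<delta>)"
        using Rp card_slice_pos[of m] by (intro mult_strict_left_mono) auto
      also have "\<dots> \<le> 29/100 * real (card B)" using B(2) by simp
      finally show False by simp
    qed
  qed
qed

section \<open>The set of low-weight vectors is closed\<close>

text \<open>A set \<open>b\<close> is determined by its parts inside and outside \<open>W\<close>,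
  chosen independently; these are the hypergeometric counts.\<close>

lemma card_subsets_inter:
  assumes N: "finite N" and W: "W \<subseteq> N" and "j \<le> m"
  shows "card {b. b \<subseteq> N \<and> card b = m \<and> card (b \<inter> W) = j}
    = (card W choose j) * ((card N - card W) choose (m - j))"
proof -
  have finW: "finite W" using N W finite_subset by blast
  let ?P = "{c. c \<subseteq> W \<and> card c = j} \<times> {d. d \<subseteq> N - W \<and> card d = m - j}"
  have "bij_betw (\<lambda>b. (b \<inter> W, b - W)) {b. b \<subseteq> N \<and> card b = m \<and> card (b \<inter> W) = j} ?P"
  proof (rule bij_betw_byWitness[where f' = "\<lambda>(c, d). c \<union> d"])
    show "(\<lambda>b. (b \<inter> W, b - W)) ` {b. b \<subseteq> N \<and> card b = m \<and> card (b \<inter> W) = j} \<subseteq> ?P"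
    proof (intro image_subsetI)
      fix b assume b: "b \<in> {b. b \<subseteq> N \<and> card b = m \<and> card (b \<inter> W) = j}"
      then have "finite b" using N finite_subset by blast
      then have "card (b - W) = m - j" using b by (simp add: card_Diff_subset_Int)
      then show "(b \<inter> W, b - W) \<in> ?P" using b by auto
    qed
    show "(\<lambda>(c, d). c \<union> d) ` ?P \<subseteq> {b. b \<subseteq> N \<and> card b = m \<and> card (b \<inter> W) = j}"
    proof (intro image_subsetI)
      fix p assume p: "p \<in> ?P"
      obtain c d where cd: "p = (c, d)" by fastforce
      have c: "c \<subseteq> W" "card c = j" and d: "d \<subseteq> N - W" "card d = m - j" using p cd by auto
      have "finite c" "finite d" using c d finW N finite_subset by blast+
      moreover have "c \<inter> d = {}" using c d by auto
      ultimately have "card (c \<union> d) = m" using c d \<open>j \<le> m\<close> by (simp add: card_Un_disjoint)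
      moreover have "(c \<union> d) \<inter> W = c" using c d by auto
      moreover have "c \<union> d \<subseteq> N" using c d W by auto
      ultimately show "(case p of (c, d) \<Rightarrow> c \<union> d) \<in> {b. b \<subseteq> N \<and> card b = m \<and> card (b \<inter> W) = j}"
        using c cd by simp
    qed
  qed (use W in auto)
  then have "card {b. b \<subseteq> N \<and> card b = m \<and> card (b \<inter> W) = j} = card ?P"
    by (rule bij_betw_same_card)
  also have "\<dots> = (card W choose j) * (card (N - W) choose (m - j))"
    using n_subsets[OF finW, of j] n_subsets[of "N - W" "m - j"] N by (simp add: card_cartesian_product)
  also have "card (N - W) = card N - card W" using finW W by (rule card_Diff_subset)
  finally show ?thesis .
qed

text \<open>The ratio of consecutive binomial coefficients in a division-free form; for
  \<open>k \<ge> n\<close> both sides vanish.\<close>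

lemma Suc_times_binomial_Suc: "Suc k * (n choose Suc k) = (n - k) * (n choose k)"
  using binomial_absorption[of k n] binomial_absorb_comp[of n k] by simp

text \<open>Turns a power of \<open>1 - x\<close> into an exponential lower bound, since
  \<open>(1 - x) * (1 + 2 * x) \<ge> 1\<close> on this range.\<close>

lemma exp_minus_double_le:
  fixes x :: real
  assumes "0 \<le> x" "x \<le> 1 / 2"
  shows "exp (- (2 * x)) \<le> 1 - x"
proof -
  have "x * (2 * x) \<le> x * 1" using assms by (intro mult_left_mono) auto
  then have "1 \<le> (1 - x) * (1 + 2 * x)" by (simp add: algebra_simps)
  also have "\<dots> \<le> (1 - x) * exp (2 * x)"
    using assms by (intro mult_left_mono exp_ge_add_one_self) auto
  finally show ?thesis by (simp add: exp_minus field_simps)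
qed

text \<open>
  The intersection size with \<open>W\<close> is hypergeometric; consecutive probabilities near its middle differ by
  a factor \<open>1 - O(1 / \<surd>m)\<close>, so shifting by \<open>O(\<surd>m)\<close> costs only a constant factor.
\<close>

lemma card_inter_Suc_ge:
  fixes K s :: real
  defines "\<rho> \<equiv> 1 - 40 * K / s"
  assumes K: "K \<ge> 1" and s: "s = sqrt (real m)" "s \<ge> 80 * K"
    and W: "W \<subseteq> {..<m\<^sup>2}" "(real m)\<^sup>2 / 2 - 2 * K * real m * s \<le> real (card W)"
    and j: "real j \<le> real m / 2 + 4 * K * s + 2"
  shows "\<rho> * real (card {b \<in> slice m. card (b \<inter> W) = j}) \<le> real (card {b \<in> slice m. card (b \<inter> W) = Suc j})"
proof -
  \<comment> \<open>The ratio of consecutive counts is \<open>(w - j) (m - j)\<close> over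
    \<open>(j + 1) (v - p)\<close>. The bounds \<open>b1\<close> to \<open>b4\<close> compare its
    factors with \<open>m^2 / 2\<close> and \<open>m / 2\<close> up to a relative error
    \<open>z\<close>, so the ratio is at least \<open>(1 - z)^2 / (1 + z)^2\<close>, hence at least
    \<open>1 - 4 z = \<rho>\<close>.\<close>
  define z where "z = 10 * K / s"
  have sp: "s \<ge> 80" using K s by linarith
  have sm: "real m = s * s" using s(1) by simp
  have z: "0 \<le> z" "z \<le> 1 / 8" using s(2) K sp by (auto simp: z_def field_simps)
  have zs: "z * s = 10 * K" using sp by (simp add: z_def)
  have Ks: "K * s \<ge> 80" using mult_mono[of 1 K 80 s] K sp by simp
  define w where "w = card W"
  define v where "v = m\<^sup>2 - w"
  have w: "w \<le> m\<^sup>2" using card_mono[OF _ W(1)] by (simp add: w_def)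
  have finW: "finite W" using W(1) finite_subset by blast
  have Km: "K * (real m * s) \<ge> 80 * real m"
    using mult_right_mono[OF Ks, of "real m"] by (simp add: mult_ac)
  have mbig: "real m \<ge> 80 * s" using sm sp by (simp add: mult_right_mono)
  have mK: "real m \<ge> 80 * (K * s)"
    using mult_right_mono[OF s(2), of s] sp sm by (simp add: mult_ac)
  have m2: "(real m)\<^sup>2 * z = 10 * (K * (real m * s))"
    using zs sm by (simp add: power2_eq_square) (metis mult.assoc mult.commute)
  have m1: "real m * z = 10 * (K * s)"
    using zs sm by (simp add: mult_ac)
  have b1: "real w - real j \<ge> (real m)\<^sup>2 / 2 * (1 - z)"
  proof -
    have "(real m)\<^sup>2 / 2 * (1 - z) = (real m)\<^sup>2 / 2 - 5 * (K * (real m * s))"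
      using m2 by (simp only: right_diff_distrib distrib_left)
    moreover have "real w \<ge> (real m)\<^sup>2 / 2 - 2 * (K * (real m * s))" using W(2) by (simp add: w_def mult_ac)
    moreover have "real j \<le> real m / 2 + 4 * (K * s) + 2" using j by (simp add: mult_ac)
    ultimately show ?thesis using Km mbig mK Ks sp by linarith
  qed
  have b2: "real m - real j \<ge> real m / 2 * (1 - z)"
  proof -
    have "real m / 2 * (1 - z) = real m / 2 - 5 * (K * s)"
      using m1 by (simp only: right_diff_distrib distrib_left)
    moreover have "real j \<le> real m / 2 + 4 * (K * s) + 2" using j by (simp add: mult_ac)
    ultimately show ?thesis using Ks by linarith
  qed
  have b3: "real j + 1 \<le> real m / 2 * (1 + z)"
  proof -
    have "real m / 2 * (1 + z) = real m / 2 + 5 * (K * s)"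
      using m1 by (simp only: right_diff_distrib distrib_left)
    moreover have "real j \<le> real m / 2 + 4 * (K * s) + 2" using j by (simp add: mult_ac)
    ultimately show ?thesis using Ks by linarith
  qed
  have b4: "(real m)\<^sup>2 - real w - real m + real j + 1 \<le> (real m)\<^sup>2 / 2 * (1 + z)"
  proof -
    have "(real m)\<^sup>2 / 2 * (1 + z) = (real m)\<^sup>2 / 2 + 5 * (K * (real m * s))"
      using m2 by (simp only: right_diff_distrib distrib_left)
    moreover have "real w \<ge> (real m)\<^sup>2 / 2 - 2 * (K * (real m * s))" using W(2) by (simp add: w_def mult_ac)
    moreover have "real j \<le> real m / 2 + 4 * (K * s) + 2" using j by (simp add: mult_ac)
    ultimately show ?thesis using Km mbig mK Ks sp by linarith
  qed
  have mp: "real m > 0" using sm sp by simp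
  have "real m / 2 * (1 - z) > 0" using mp z by (intro mult_pos_pos) auto
  then have jm: "j < m" using b2 by linarith
  have "(real m)\<^sup>2 / 2 * (1 - z) > 0" using mp z by (intro mult_pos_pos) auto
  then have jw: "j < w" using b1 by linarith
  define p where "p = m - Suc j"
  have mj: "m - j = Suc p" "m - Suc j = p" using jm by (auto simp: p_def)
  have N: "card {b \<in> slice m. card (b \<inter> W) = i} = (w choose i) * (v choose (m - i))" if "i \<le> m" for i
    using card_subsets_inter[of "{..<m\<^sup>2}" W i m] W(1) that
    by (simp add: slice_def w_def v_def conj_assoc)
  let ?N = "\<lambda>i. real (card {b \<in> slice m. card (b \<inter> W) = i})"
  let ?A = "(real w - real j) * (real m - real j)" and ?B = "(real j + 1) * real (v - p)"
  have "Suc j * (v - p) * card {b \<in> slice m. card (b \<inter> W) = Suc j}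
      = (Suc j * (w choose Suc j)) * ((v - p) * (v choose p))"
    unfolding N[OF Suc_leI[OF jm]] mj by (simp only: mult_ac)
  also have "\<dots> = ((w - j) * (w choose j)) * (Suc p * (v choose Suc p))"
    unfolding Suc_times_binomial_Suc ..
  also have "\<dots> = (w - j) * (m - j) * card {b \<in> slice m. card (b \<inter> W) = j}"
    unfolding N[OF less_imp_le[OF jm]] mj by (simp only: mult_ac)
  finally have "real (Suc j * (v - p) * card {b \<in> slice m. card (b \<inter> W) = Suc j})
    = real ((w - j) * (m - j) * card {b \<in> slice m. card (b \<inter> W) = j})" by (rule arg_cong)
  then have eq: "?B * ?N (Suc j) = ?A * ?N j"
    unfolding of_nat_mult of_nat_Suc of_nat_diff[OF less_imp_le[OF jm]] of_nat_diff[OF less_imp_le[OF jw]]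
    by (simp only: add.commute)
  \<comment> \<open>The subtraction of naturals truncates to 0 when \<open>p > v\<close>, where the
    bound is trivial.\<close>
  have vp: "real (v - p) \<le> (real m)\<^sup>2 / 2 * (1 + z)"
  proof (cases "p \<le> v")
    case True
    then have "real (v - p) = (real m)\<^sup>2 - real w - real m + real j + 1"
      using w jm by (simp add: of_nat_diff v_def p_def)
    then show ?thesis using b4 by simp
  qed (use z in simp)
  have quad: "(1 - 4 * z) * ((1 + z) * (1 + z)) \<le> (1 - z) * (1 - z)"
  proof -
    have "(1 - z) * (1 - z) - (1 - 4 * z) * ((1 + z) * (1 + z)) = 8 * (z * z) + 4 * (z * z * z)"
      by (simp add: algebra_simps)
    also have "\<dots> \<ge> 0" using z by simp
    finally show ?thesis by simp
  qed
  have \<rho>: "\<rho> = 1 - 4 * z" by (simp add: \<rho>_def z_def)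
  then have \<rho>0: "\<rho> \<ge> 0" using z by simp
  have "?B \<le> (real m / 2 * (1 + z)) * ((real m)\<^sup>2 / 2 * (1 + z))"
    using b3 vp z by (intro mult_mono) auto
  then have "\<rho> * ?B \<le> \<rho> * ((real m / 2 * (1 + z)) * ((real m)\<^sup>2 / 2 * (1 + z)))"
    using \<rho>0 by (rule mult_left_mono)
  also have "\<dots> = (real m / 2 * ((real m)\<^sup>2 / 2)) * ((1 - 4 * z) * ((1 + z) * (1 + z)))"
    unfolding \<rho> by (simp only: mult_ac)
  also have "\<dots> \<le> (real m / 2 * ((real m)\<^sup>2 / 2)) * ((1 - z) * (1 - z))"
    by (rule mult_left_mono[OF quad]) simp
  also have "\<dots> = ((real m)\<^sup>2 / 2 * (1 - z)) * (real m / 2 * (1 - z))" by (simp only: mult_ac)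
  also have "\<dots> \<le> ?A"
    using b1 b2 z jw by (intro mult_mono) auto
  finally have AB: "\<rho> * ?B \<le> ?A" .
  show ?thesis
  proof (cases "p < v")
    case True
    then have Bp: "?B > 0" by simp
    have "?B * (\<rho> * ?N j) = (\<rho> * ?B) * ?N j" by (simp only: mult_ac)
    also have "\<dots> \<le> ?A * ?N j" by (rule mult_right_mono[OF AB]) simp
    also have "\<dots> = ?B * ?N (Suc j)" by (simp only: eq)
    finally show ?thesis using Bp by (rule mult_left_le_imp_le)
  next
    \<comment> \<open>Now \<open>v < Suc p\<close>, so no \<open>b\<close> meets \<open>W\<close> in
      exactly \<open>j\<close> points.\<close>
    case False
    then have "card {b \<in> slice m. card (b \<inter> W) = j} = 0"
      unfolding N[OF less_imp_le[OF jm]] mj by (simp add: binomial_eq_0)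
    then show ?thesis by (simp only: of_nat_0 mult_zero_right of_nat_0_le_iff)
  qed
qed

lemma sum_sg_slice:
  assumes "b \<in> slice m"
  shows "(\<Sum>i\<in>b. sg W i) = real m - 2 * real (card (b \<inter> W))"
proof -
  have fin: "finite b" using assms finite_subset unfolding slice_def by blast
  have "(\<Sum>i\<in>b. sg W i) = (\<Sum>i\<in>b. 1 - 2 * (if i \<in> W then 1 else 0))"
    by (intro sum.cong refl) (simp add: sg_def)
  also have "\<dots> = real (card b) - 2 * (\<Sum>i\<in>b. if i \<in> W then 1 else 0)"
    by (simp add: sum_subtractf sum_distrib_left)
  also have "(\<Sum>i\<in>b. if i \<in> W then 1 else 0) = real (card (b \<inter> W))"
    using fin by (simp add: sum.inter_restrict[symmetric])
  finally show ?thesis using assms by (simp add: slice_def)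
qed

lemma sum_sg:
  assumes "W \<subseteq> {..<n}"
  shows "(\<Sum>i<n. sg W i) = real n - 2 * real (card W)"
proof -
  have "(\<Sum>i<n. sg W i) = (\<Sum>i<n. 1 - 2 * (if i \<in> W then 1 else 0))"
    by (intro sum.cong refl) (simp add: sg_def)
  also have "\<dots> = real n - 2 * (\<Sum>i<n. if i \<in> W then 1 else 0)"
    by (simp add: sum_subtractf sum_distrib_left)
  also have "(\<Sum>i<n. if i \<in> W then 1 else 0) = real (card W)"
    using assms by (simp add: sum.inter_restrict[symmetric] Int_absorb1)
  finally show ?thesis .
qed

text \<open>The lower tail of the intersection size. Since \<open>m * (8 K / s) = 8 K s\<close>, the
  event says that \<open>V i = 8 K / s - sg W i\<close> has non-positive sum over \<open>b\<close>.
  As \<open>W\<close> misses at most \<open>2 K m s\<close> of half of the points, \<open>V\<close>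
  has mean at least \<open>4 K / s\<close>; \<open>lam = K / s\<close> gives the bound
  \<open>2 * exp (- 2 K^2)\<close>, at most one half.\<close>

lemma card_small_inter_le:
  fixes K s :: real
  assumes K: "K \<ge> 1" and s: "s = sqrt (real m)" "s \<ge> 80 * K"
    and W: "W \<subseteq> {..<m\<^sup>2}" "(real m)\<^sup>2 / 2 - 2 * K * real m * s \<le> real (card W)"
      "real (card W) \<le> (real m)\<^sup>2 / 2"
  shows "real (card {b \<in> slice m. 2 * real (card (b \<inter> W)) \<le> real m - 8 * K * s}) \<le> 1 / 2 * real (card (slice m))"
proof -
  have sp: "s \<ge> 80" using K s by linarith
  have sm: "real m = s * s" using s(1) by simp
  have m: "m \<ge> 1" using sm sp by (cases "m = 0") auto
  define V where "V i = 8 * K / s - sg W i" for i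
  have Ks: "K / s \<ge> 0" "K / s \<le> 1 / 80" using K s(2) sp by (auto simp: field_simps)
  have tot: "(\<Sum>i<m\<^sup>2. sg W i) = (real m)\<^sup>2 - 2 * real (card W)"
    using sum_sg[OF W(1)] by simp
  have eq: "{b \<in> slice m. 2 * real (card (b \<inter> W)) \<le> real m - 8 * K * s} = {b \<in> slice m. (\<Sum>i\<in>b. V i) \<le> 0}"
  proof -
    have "(\<Sum>i\<in>b. V i) = 8 * K * s - (real m - 2 * real (card (b \<inter> W)))" if b: "b \<in> slice m" for b
    proof -
      have "(\<Sum>i\<in>b. V i) = real m * (8 * K / s) - (real m - 2 * real (card (b \<inter> W)))"
        using b sum_sg_slice[OF b] by (simp add: V_def sum_subtractf slice_def)
      also have "real m * (8 * K / s) = 8 * K * s" using sm sp by simp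
      finally show ?thesis .
    qed
    then show ?thesis by auto
  qed
  have "real (card {b \<in> slice m. (\<Sum>i\<in>b. V i) \<le> 0})
      \<le> 2 * real (card (slice m)) * exp (real m * ((K / s)\<^sup>2 * 2 - (K / s) * (4 * (K / s))))"
  proof (rule slice_tail[OF m Ks(1)])
    fix i
    have "V i = 8 * (K / s) - sg W i" by (simp add: V_def)
    then have "\<bar>V i\<bar> \<le> 8 * (K / s) + 1"
      using abs_triangle_ineq4[of "8 * (K / s)" "sg W i"] Ks(1) by simp
    then have "\<bar>V i\<bar> \<le> 2" using Ks(2) by linarith
    then have "K / s * \<bar>V i\<bar> \<le> 1 / 80 * 2" using Ks by (intro mult_mono) auto
    then show "\<bar>K / s * V i\<bar> \<le> 1" unfolding abs_mult abs_of_nonneg[OF Ks(1)] by linarith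
  next
    have "(\<Sum>i<m\<^sup>2. V i) = (real m)\<^sup>2 * (8 * (K / s)) - ((real m)\<^sup>2 - 2 * real (card W))"
      using tot by (simp add: V_def sum_subtractf)
    moreover have "(real m)\<^sup>2 * (8 * (K / s)) = 8 * (K * real m * s)" "(real m)\<^sup>2 * (4 * (K / s)) = 4 * (K * real m * s)"
      using sm sp by (simp_all add: power2_eq_square)
    moreover have "(real m)\<^sup>2 / 2 - 2 * (K * real m * s) \<le> real (card W)" using W(2) by (simp add: mult.assoc)
    ultimately show "(real m)\<^sup>2 * (4 * (K / s)) \<le> (\<Sum>i<m\<^sup>2. V i)" by argo
  next
    \<comment> \<open>Expanding the square, the cross term may be dropped because the signs of
      \<open>W\<close> have non-negative total when \<open>W\<close> contains at most half of the
      points.\<close>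
    have "(\<Sum>i<m\<^sup>2. (V i)\<^sup>2) = (\<Sum>i<m\<^sup>2. (8 * (K / s))\<^sup>2 + 1 - 2 * (8 * (K / s)) * sg W i)"
      by (intro sum.cong refl) (auto simp: V_def sg_def power2_eq_square algebra_simps)
    also have "\<dots> = (real m)\<^sup>2 * ((8 * (K / s))\<^sup>2 + 1) - 2 * (8 * (K / s)) * ((real m)\<^sup>2 - 2 * real (card W))"
      unfolding tot[symmetric] by (simp only: sum_subtractf sum_distrib_left[symmetric]) simp
    also have "\<dots> \<le> (real m)\<^sup>2 * ((8 * (K / s))\<^sup>2 + 1)"
    proof -
      have "0 \<le> 2 * (8 * (K / s)) * ((real m)\<^sup>2 - 2 * real (card W))"
        by (intro mult_nonneg_nonneg) (use W(3) Ks(1) in auto)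
      then show ?thesis by simp
    qed
    also have "\<dots> \<le> (real m)\<^sup>2 * 2"
    proof (rule mult_left_mono)
      have "(8 * (K / s))\<^sup>2 \<le> 1"
      proof (rule power_le_one)
        show "0 \<le> 8 * (K / s)" "8 * (K / s) \<le> 1" using Ks by linarith+
      qed
      then show "(8 * (K / s))\<^sup>2 + 1 \<le> 2" by simp
    qed simp
    finally show "(\<Sum>i<m\<^sup>2. (V i)\<^sup>2) \<le> (real m)\<^sup>2 * 2" .
  qed
  also have "real m * ((K / s)\<^sup>2 * 2 - (K / s) * (4 * (K / s))) = - 2 * (K * K)"
    using sm sp by (simp add: power2_eq_square field_simps)
  also have "exp (- 2 * (K * K)) \<le> 1 / 4"
  proof -
    have "K * K \<ge> 1" using mult_mono[of 1 K 1 K] K by simp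
    then have "exp (- 2 * (K * K)) \<le> exp (- 2)" by simp
    also have "exp (- 2 :: real) \<le> 1 / 4"
    proof -
      have "exp (2::real) = exp 1 * exp 1" by (simp add: exp_add[symmetric])
      moreover have "exp (1::real) \<ge> 2" using exp_ge_add_one_self[of "1::real"] by simp
      ultimately have "exp (2::real) \<ge> 2 * 2" by (simp only:) (intro mult_mono, auto)
      then show ?thesis by (simp add: exp_minus field_simps)
    qed
    finally show ?thesis .
  qed
  finally show ?thesis unfolding eq by (simp add: mult_left_mono)
qed

text \<open>By \<open>card_small_inter_le\<close>, at least half of the slice meets \<open>W\<close>
  in at least \<open>h\<close> points or in a number of points in the window of length
  \<open>D\<close> below \<open>h\<close>. Shifting the window up by \<open>D\<close> lands in the
  wanted set and, by \<open>D\<close> uses of \<open>card_inter_Suc_ge\<close>, costs at most the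
  factor \<open>\<rho> ^ D \<ge> exp (- 400 * K\<^sup>2)\<close>.\<close>

lemma card_large_inter_ge:
  fixes K s :: real
  assumes K: "K \<ge> 1" and s: "s = sqrt (real m)" "s \<ge> 80 * K"
    and W: "W \<subseteq> {..<m\<^sup>2}" "(real m)\<^sup>2 / 2 - 2 * K * real m * s \<le> real (card W)"
      "real (card W) \<le> (real m)\<^sup>2 / 2"
  shows "exp (- 400 * K\<^sup>2) / 4 * real (card (slice m)) \<le> real (card {b \<in> slice m. m \<le> 2 * card (b \<inter> W)})"
proof -
  define c where "c = exp (- 400 * K\<^sup>2)"
  \<comment> \<open>\<open>h\<close> is \<open>m / 2\<close> rounded up, the least size with
    \<open>m \<le> 2 * h\<close>; \<open>D\<close> is \<open>4 K s\<close> rounded up.\<close>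
  define h where "h = (m + 1) div 2"
  define D where "D = nat \<lceil>4 * K * s\<rceil>"
  define \<rho> where "\<rho> = 1 - 40 * K / s"
  have sp: "s \<ge> 80" using K s by linarith
  have Ks': "0 \<le> 40 * K / s" "40 * K / s \<le> 1 / 2"
    using K s(2) sp by (auto simp: field_simps)
  then have \<rho>: "0 \<le> \<rho>" "exp (- (2 * (40 * K / s))) \<le> \<rho>"
    unfolding \<rho>_def using exp_minus_double_le[OF Ks'] by auto
  have Ks: "K * s \<ge> 80" using mult_mono[of 1 K 80 s] K sp by simp
  have D: "4 * K * s \<le> real D" "real D \<le> 4 * K * s + 1"
    using Ks unfolding D_def by (auto intro: real_nat_ceiling_ge)
  have h: "2 * h \<ge> m" "2 * h \<le> m + 1" by (auto simp: h_def)
  let ?N = "\<lambda>j. {b \<in> slice m. card (b \<inter> W) = j}"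
  let ?G = "{b \<in> slice m. m \<le> 2 * card (b \<inter> W)}"
  have step: "\<rho> ^ i * real (card (?N j)) \<le> real (card (?N (j + i)))" if "j < h" "i \<le> D" for i j
    using that(2)
  proof (induction i)
    case (Suc i)
    have "\<rho> ^ Suc i * real (card (?N j)) = \<rho> * (\<rho> ^ i * real (card (?N j)))" by simp
    also have "\<dots> \<le> \<rho> * real (card (?N (j + i)))"
      using Suc \<rho>(1) by (intro mult_left_mono) auto
    also have "\<dots> \<le> real (card (?N (Suc (j + i))))"
      unfolding \<rho>_def
    proof (rule card_inter_Suc_ge[OF K s W(1,2)])
      have "2 * (j + i) + 4 \<le> m + 1 + 2 * D" using Suc.prems \<open>j < h\<close> h by presburger
      then have le: "2 * real (j + i) + 4 \<le> real m + 1 + 2 * real D" by linarith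
      define t where "t = real (j + i)"
      from le have "2 * t + 4 \<le> real m + 1 + 2 * real D" unfolding t_def .
      then show "real (j + i) \<le> real m / 2 + 4 * K * s + 2" unfolding t_def[symmetric] using D by linarith
    qed
    finally show ?case by simp
  qed simp
  have "c \<le> \<rho> ^ D"
  proof -
    have "c \<le> exp (- (2 * (40 * K / s)) * real D)"
    proof -
      \<comment> \<open>Rounding up is absorbed by \<open>D \<le> 4 K s + 1 \<le> 5 K s\<close>,
        giving \<open>80 * 5 = 400\<close>.\<close>
      have "2 * (40 * K / s) * real D \<le> 2 * (40 * K / s) * (5 * (K * s))"
        using D Ks K sp by (intro mult_left_mono) auto
      also have "\<dots> = 400 * K\<^sup>2" using sp by (simp add: power2_eq_square)
      finally show ?thesis by (simp add: c_def)
    qed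
    also have "\<dots> = exp (- (2 * (40 * K / s))) ^ D"
      by (simp add: exp_of_nat_mult[symmetric] mult.commute)
    also have "\<dots> \<le> \<rho> ^ D" by (intro power_mono \<rho>) auto
    finally show ?thesis .
  qed
  let ?I = "{h - D..<h}"
  have "c * (\<Sum>j\<in>?I. real (card (?N j))) = (\<Sum>j\<in>?I. c * real (card (?N j)))"
    by (rule sum_distrib_left)
  also have "\<dots> \<le> (\<Sum>j\<in>?I. real (card (?N (j + D))))"
  proof (rule sum_mono)
    fix j assume "j \<in> ?I"
    have "c * real (card (?N j)) \<le> \<rho> ^ D * real (card (?N j))"
      using \<open>c \<le> \<rho> ^ D\<close> by (rule mult_right_mono) simp
    also have "\<dots> \<le> real (card (?N (j + D)))" using step[of j D] \<open>j \<in> ?I\<close> by simp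
    finally show "c * real (card (?N j)) \<le> real (card (?N (j + D)))" .
  qed
  also have "\<dots> = real (\<Sum>j\<in>?I. card (?N (j + D)))" by simp
  also have "(\<Sum>j\<in>?I. card (?N (j + D))) = card (\<Union>j\<in>?I. ?N (j + D))"
    by (rule card_UN_disjoint[symmetric]) auto
  also have "\<dots> \<le> card ?G"
    using h by (intro card_mono) auto
  finally have mid: "c * (\<Sum>j\<in>?I. real (card (?N j))) \<le> real (card ?G)" by simp
  have sub: "slice m \<subseteq> {b \<in> slice m. 2 * real (card (b \<inter> W)) \<le> real m - 8 * K * s} \<union> (?G \<union> (\<Union>j\<in>?I. ?N j))"
  proof
    fix b assume b: "b \<in> slice m"
    consider "card (b \<inter> W) \<ge> h" | "card (b \<inter> W) \<in> ?I" | "card (b \<inter> W) < h - D"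
      by (auto simp: not_le not_less) (meson not_le)
    then show "b \<in> {b \<in> slice m. 2 * real (card (b \<inter> W)) \<le> real m - 8 * K * s} \<union> (?G \<union> (\<Union>j\<in>?I. ?N j))"
    proof cases
      case 1
      then have "m \<le> 2 * card (b \<inter> W)" using h by linarith
      then show ?thesis using b by simp
    next
      case 2
      then show ?thesis using b by blast
    next
      case 3
      then have "2 * card (b \<inter> W) + 2 * D + 2 \<le> m + 1" using h by linarith
      then have "2 * real (card (b \<inter> W)) + 2 * real D + 2 \<le> real m + 1" by linarith
      then have "2 * real (card (b \<inter> W)) \<le> real m - 8 * K * s" using D by linarith
      then show ?thesis using b by simp
    qed
  qed
  have "card (slice m) \<le> card ({b \<in> slice m. 2 * real (card (b \<inter> W)) \<le> real m - 8 * K * s} \<union> (?G \<union> (\<Union>j\<in>?I. ?N j)))"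
    using sub by (rule card_mono[rotated]) auto
  also have "\<dots> \<le> card {b \<in> slice m. 2 * real (card (b \<inter> W)) \<le> real m - 8 * K * s} + (card ?G + (\<Sum>j\<in>?I. card (?N j)))"
    by (intro order_trans[OF card_Un_le] add_left_mono card_UN_le) auto
  finally have "real (card (slice m)) \<le> real (card {b \<in> slice m. 2 * real (card (b \<inter> W)) \<le> real m - 8 * K * s})
      + (real (card ?G) + (\<Sum>j\<in>?I. real (card (?N j))))"
    unfolding of_nat_sum[symmetric] of_nat_add[symmetric] of_nat_le_iff .
  then have half: "1 / 2 * real (card (slice m)) \<le> real (card ?G) + (\<Sum>j\<in>?I. real (card (?N j)))"
    using card_small_inter_le[OF K s W] by linarith
  have c: "0 < c" "c \<le> 1" by (auto simp: c_def)
  \<comment> \<open>\<open>?G\<close> is counted twice, once itself and once as the target of the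
    shift; with the half this yields \<open>c / 4\<close>.\<close>
  have "c * (1 / 2 * real (card (slice m))) \<le> c * (real (card ?G) + (\<Sum>j\<in>?I. real (card (?N j))))"
    using half c by (intro mult_left_mono) auto
  also have "\<dots> \<le> real (card ?G) + real (card ?G)"
    unfolding distrib_left using mid c mult_right_mono[of c 1 "real (card ?G)"] by (intro add_mono) auto
  finally show ?thesis unfolding c_def by simp
qed

lemma card_sd_slice:
  assumes "finite a" "b \<in> slice m"
  shows "card (sd a b) + 2 * card (b \<inter> a) = card a + m"
proof -
  have fin: "finite b" and b: "card b = m"
    using assms(2) finite_subset unfolding slice_def by blast+
  have "card (sd a b) = card (a - b) + card (b - a)"
    unfolding sd_def using assms(1) fin by (intro card_Un_disjoint) auto
  moreover have "card a = card (a - b) + card (b \<inter> a)"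
    using card_Diff_subset_Int[of a b] card_mono[OF assms(1), of "a \<inter> b"] assms(1) by (simp add: Int_commute)
  moreover have "card b = card (b - a) + card (b \<inter> a)"
    using card_Diff_subset_Int[of b a] card_mono[OF fin, of "b \<inter> a"] fin by simp
  ultimately show ?thesis using b by linarith
qed

text \<open>A step raises the weight by at most \<open>m\<close>, so deep inside the ball every step
  stays. In the remaining band of width \<open>m\<close>, \<open>card_large_inter_ge\<close>
  provides enough steps that do not increase the weight.\<close>

lemma card_stay_below_ge:
  fixes K s :: real
  assumes K: "K \<ge> 1" and s: "s = sqrt (real m)" "s \<ge> 80 * K"
    and a: "a \<subseteq> {..<m\<^sup>2}" "real (card a) \<le> (real m)\<^sup>2 / 2 - K * real m * s"
  shows "exp (- 400 * K\<^sup>2) / 4 * real (card (slice m))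
    \<le> real (card {b \<in> slice m. real (card (sd a b)) \<le> (real m)\<^sup>2 / 2 - K * real m * s})" (is "_ \<le> real (card ?R)")
proof -
  have fin: "finite a" using a finite_subset by blast
  have sp: "s \<ge> 80" using K s by linarith
  have Ks: "K * s \<ge> 1" using mult_mono[of 1 K 80 s] K sp by simp
  have Kms: "K * real m * s \<ge> real m"
    using mult_left_mono[OF Ks, of "real m"] by (simp add: mult_ac)
  show ?thesis
  proof (cases "real (card a) \<le> (real m)\<^sup>2 / 2 - K * real m * s - real m")
    case True
    have "?R = slice m"
    proof -
      have "real (card (sd a b)) \<le> (real m)\<^sup>2 / 2 - K * real m * s" if "b \<in> slice m" for b
        using card_sd_slice[OF fin that] True by linarith
      then show ?thesis by auto
    qed
    moreover have "exp (- 400 * K\<^sup>2) / 4 * real (card (slice m)) \<le> 1 * real (card (slice m))"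
    proof (rule mult_right_mono)
      have "exp (- 400 * K\<^sup>2) \<le> 1" by simp
      then show "exp (- 400 * K\<^sup>2) / 4 \<le> 1" by linarith
    qed simp
    ultimately show ?thesis by simp
  next
    case False
    then have "(real m)\<^sup>2 / 2 - 2 * K * real m * s \<le> real (card a)" using Kms by simp
    moreover have "real (card a) \<le> (real m)\<^sup>2 / 2" using a(2) Kms by simp
    ultimately have "exp (- 400 * K\<^sup>2) / 4 * real (card (slice m)) \<le> real (card {b \<in> slice m. m \<le> 2 * card (b \<inter> a)})"
      by (rule card_large_inter_ge[OF K s a(1)])
    also have "card {b \<in> slice m. m \<le> 2 * card (b \<inter> a)} \<le> card ?R"
    proof (rule card_mono)
      have "real (card (sd a b)) \<le> (real m)\<^sup>2 / 2 - K * real m * s" if "b \<in> slice m" "m \<le> 2 * card (b \<inter> a)" for b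
      proof -
        have "card (sd a b) \<le> card a" using card_sd_slice[OF fin that(1)] that(2) by linarith
        then show ?thesis using a(2) by linarith
      qed
      then show "{b \<in> slice m. m \<le> 2 * card (b \<inter> a)} \<subseteq> ?R" by auto
    qed simp
    finally show ?thesis by simp
  qed
qed

section \<open>Transfer to the group of vectors\<close>

definition supp :: "nat \<Rightarrow> (nat \<Rightarrow> int) \<Rightarrow> nat set" where
  "supp n v = {i \<in> {..<n}. v i = 1}"

lemma weight_eq_card_supp: "weight n v = card (supp n v)"
  by (simp add: weight_def supp_def)

lemma supp_subset: "supp n v \<subseteq> {..<n}"
  by (auto simp: supp_def)

lemma carrier_F2: "carrier (F2 n) = {..<n} \<rightarrow>\<^sub>E {0, 1}"
proof -
  have "{0..<2::int} = {0, 1}" by auto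
  then show ?thesis by (simp add: F2_def carrier_integer_mod_group)
qed

lemma mult_F2: "i < n \<Longrightarrow> (v \<otimes>\<^bsub>F2 n\<^esub> w) i = (v i + w i) mod 2"
  by (simp add: F2_def)

lemma finite_carrier_F2 [simp]: "finite (carrier (F2 n))"
  unfolding carrier_F2 by (rule finite_PiE) auto

lemma supp_mult:
  assumes "v \<in> carrier (F2 n)" "w \<in> carrier (F2 n)"
  shows "supp n (v \<otimes>\<^bsub>F2 n\<^esub> w) = sd (supp n v) (supp n w)"
proof -
  have "(v \<otimes>\<^bsub>F2 n\<^esub> w) i = 1 \<longleftrightarrow> \<not> (v i = 1 \<longleftrightarrow> w i = 1)" if "i < n" for i
  proof -
    have "v i \<in> {0, 1}" "w i \<in> {0, 1}" using assms that unfolding carrier_F2 by auto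
    then show ?thesis using mult_F2[OF that, of v w] by auto
  qed
  then show ?thesis by (auto simp: supp_def sd_def)
qed

lemma inj_on_supp: "inj_on (supp n) (carrier (F2 n))"
proof (rule inj_onI)
  fix v w assume vw: "v \<in> carrier (F2 n)" "w \<in> carrier (F2 n)" "supp n v = supp n w"
  show "v = w"
  proof (rule PiE_ext)
    show "v \<in> {..<n} \<rightarrow>\<^sub>E {0, 1}" "w \<in> {..<n} \<rightarrow>\<^sub>E {0, 1}" using vw by (auto simp: carrier_F2)
    fix i assume i: "i \<in> {..<n}"
    then have "v i \<in> {0, 1}" "w i \<in> {0, 1}" using vw unfolding carrier_F2 by auto
    moreover have "v i = 1 \<longleftrightarrow> w i = 1" using vw(3) i unfolding supp_def by blast
    ultimately show "v i = w i" by auto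
  qed
qed

lemma supp_image_carrier_F2: "supp n ` carrier (F2 n) = Pow {..<n}"
proof (intro equalityI subsetI)
  fix x assume x: "x \<in> Pow {..<n}"
  let ?v = "\<lambda>i\<in>{..<n}. if i \<in> x then 1 else 0 :: int"
  have "?v \<in> carrier (F2 n)" by (auto simp: carrier_F2)
  moreover have "supp n ?v = x" using x by (auto simp: supp_def)
  ultimately show "x \<in> supp n ` carrier (F2 n)" by (metis imageI)
qed (use supp_subset in auto)

lemma supp_image_Collect:
  "supp n ` {v \<in> carrier (F2 n). P (supp n v)} = {x. x \<subseteq> {..<n} \<and> P x}"
proof -
  have "supp n ` {v \<in> carrier (F2 n). P (supp n v)} = {x \<in> supp n ` carrier (F2 n). P x}" by blast
  then show ?thesis unfolding supp_image_carrier_F2 by simp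
qed

lemma mult_self_F2:
  assumes "v \<in> carrier (F2 n)"
  shows "v \<otimes>\<^bsub>F2 n\<^esub> v = \<one>\<^bsub>F2 n\<^esub>"
proof -
  interpret comm_group "F2 n" by (rule comm_group_F2)
  have "supp n \<one>\<^bsub>F2 n\<^esub> = {}" by (auto simp: supp_def F2_def)
  moreover have "supp n (v \<otimes>\<^bsub>F2 n\<^esub> v) = {}" using supp_mult[OF assms assms] by (simp add: sd_def)
  ultimately show ?thesis using inj_onD[OF inj_on_supp] assms by (metis m_closed one_closed)
qed

lemma weight_mult_le:
  assumes "v \<in> carrier (F2 n)" "w \<in> carrier (F2 n)"
  shows "weight n (v \<otimes>\<^bsub>F2 n\<^esub> w) \<le> weight n v + weight n w"
proof -
  have fin: "finite (supp n u)" for u using supp_subset finite_subset by blast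
  have "card (sd (supp n v) (supp n w)) \<le> card (supp n v \<union> supp n w)"
    by (rule card_mono) (use fin in \<open>auto simp: sd_def\<close>)
  then show ?thesis
    using card_Un_le[of "supp n v" "supp n w"] by (simp add: weight_eq_card_supp supp_mult[OF assms])
qed

lemma weight_finprod_le:
  assumes "finite I" "f \<in> I \<rightarrow> carrier (F2 n)" "\<And>i. i \<in> I \<Longrightarrow> weight n (f i) \<le> k"
  shows "weight n (finprod (F2 n) f I) \<le> card I * k"
  using assms
proof (induction I rule: finite_induct)
  case empty
  interpret comm_group "F2 n" by (rule comm_group_F2)
  have "weight n \<one>\<^bsub>F2 n\<^esub> = 0" by (auto simp: weight_def F2_def)
  then show ?case by simp
next
  case (insert i I)
  interpret comm_group "F2 n" by (rule comm_group_F2)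
  have cl: "f i \<in> carrier (F2 n)" "f \<in> I \<rightarrow> carrier (F2 n)" using insert.prems by auto
  have "weight n (finprod (F2 n) f (insert i I)) \<le> weight n (f i) + weight n (finprod (F2 n) f I)"
    using insert.hyps cl by (simp add: weight_mult_le)
  also have "\<dots> \<le> k + card I * k"
    using insert.IH cl insert.prems by (intro add_mono) auto
  finally show ?case using insert.hyps by simp
qed

text \<open>Stated for arbitrary binary operations so that it serves both the passage to supports
  and the transport along injective group homomorphisms.\<close>

lemma card_closed_pairs_image:
  assumes inj: "inj_on h U" and sub: "A \<subseteq> U" "B \<subseteq> U"
    and hom: "\<And>a b. a \<in> A \<Longrightarrow> b \<in> B \<Longrightarrow> f a b \<in> U \<and> h (f a b) = g (h a) (h b)"
  shows "card {(x, y) \<in> h ` A \<times> h ` B. g x y \<in> h ` A} = card {(a, b) \<in> A \<times> B. f a b \<in> A}"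
proof -
  have "bij_betw (map_prod h h) {(a, b) \<in> A \<times> B. f a b \<in> A} {(x, y) \<in> h ` A \<times> h ` B. g x y \<in> h ` A}"
    unfolding bij_betw_def
  proof
    have "inj_on h A" "inj_on h B" using inj sub inj_on_subset by blast+
    then show "inj_on (map_prod h h) {(a, b) \<in> A \<times> B. f a b \<in> A}"
      by (auto simp: inj_on_def)
    have iff: "g (h a) (h b) \<in> h ` A \<longleftrightarrow> f a b \<in> A" if "a \<in> A" "b \<in> B" for a b
      using hom[OF that] inj sub(1) by (metis inj_on_image_mem_iff)
    show "map_prod h h ` {(a, b) \<in> A \<times> B. f a b \<in> A} = {(x, y) \<in> h ` A \<times> h ` B. g x y \<in> h ` A}"
      using iff by (auto simp: image_iff)
  qed
  then show ?thesis by (rule bij_betw_same_card[symmetric])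
qed

lemma card_closed_pairs_F2:
  assumes "A \<subseteq> carrier (F2 n)" "B \<subseteq> carrier (F2 n)"
  shows "card {(a, b) \<in> A \<times> B. a \<otimes>\<^bsub>F2 n\<^esub> b \<in> A} = card (stay (supp n ` A) (supp n ` B))"
proof -
  interpret comm_group "F2 n" by (rule comm_group_F2)
  show ?thesis unfolding stay_def
  proof (rule card_closed_pairs_image[OF inj_on_supp assms, symmetric])
    fix a b assume "a \<in> A" "b \<in> B"
    then have "a \<in> carrier (F2 n)" "b \<in> carrier (F2 n)" using assms by auto
    then show "a \<otimes>\<^bsub>F2 n\<^esub> b \<in> carrier (F2 n) \<and> supp n (a \<otimes>\<^bsub>F2 n\<^esub> b) = sd (supp n a) (supp n b)"
      by (simp add: supp_mult)
  qed
qed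

text \<open>With \<open>K = 10 ^ 20\<close> this is the set \<open>A\<close> of the theorem, and
  \<open>root_sphere\<close> is its set \<open>B\<close>.\<close>

definition low_ball :: "real \<Rightarrow> nat \<Rightarrow> (nat \<Rightarrow> int) set" where
  "low_ball K n = {v \<in> carrier (F2 n). real (weight n v) \<le> real n / 2 - K * real n powr (3 / 4)}"

definition root_sphere :: "nat \<Rightarrow> (nat \<Rightarrow> int) set" where
  "root_sphere n = {v \<in> carrier (F2 n). real (weight n v) = real n powr (1 / 2)}"

lemma powr_square:
  "real (m\<^sup>2) powr (1 / 2) = real m" "real (m\<^sup>2) powr (3 / 4) = real m * sqrt (real m)"
proof -
  show "real (m\<^sup>2) powr (1 / 2) = real m" by (simp add: powr_half_sqrt)
  show "real (m\<^sup>2) powr (3 / 4) = real m * sqrt (real m)"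
  proof (cases "m = 0")
    case False
    then have "real (m\<^sup>2) powr (3 / 4) = real m powr (1 + 1 / 2)"
      by (simp add: powr_powr flip: powr_numeral)
    also have "\<dots> = real m * sqrt (real m)" unfolding powr_add using False by (simp add: powr_half_sqrt)
    finally show ?thesis .
  qed simp
qed

lemma supp_image_root_sphere: "supp (m\<^sup>2) ` root_sphere (m\<^sup>2) = slice m"
proof -
  have "root_sphere (m\<^sup>2) = {v \<in> carrier (F2 (m\<^sup>2)). card (supp (m\<^sup>2) v) = m}"
    unfolding root_sphere_def powr_square weight_eq_card_supp by simp
  then show ?thesis
    using supp_image_Collect[of "m\<^sup>2" "\<lambda>x. card x = m"] by (simp add: slice_def)
qed

lemma supp_image_low_ball:
  "supp (m\<^sup>2) ` low_ball K (m\<^sup>2)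
    = {x. x \<subseteq> {..<m\<^sup>2} \<and> real (card x) \<le> (real m)\<^sup>2 / 2 - K * real m * sqrt (real m)}"
proof -
  have "low_ball K (m\<^sup>2) = {v \<in> carrier (F2 (m\<^sup>2)).
      real (card (supp (m\<^sup>2) v)) \<le> (real m)\<^sup>2 / 2 - K * real m * sqrt (real m)}"
    unfolding low_ball_def powr_square weight_eq_card_supp by (simp add: mult.assoc)
  then show ?thesis
    using supp_image_Collect[of "m\<^sup>2" "\<lambda>x. real (card x) \<le> (real m)\<^sup>2 / 2 - K * real m * sqrt (real m)"]
    by simp
qed

lemma card_supp_image: "A \<subseteq> carrier (F2 n) \<Longrightarrow> card (supp n ` A) = card A"
  by (rule card_image) (rule inj_on_subset[OF inj_on_supp])

text \<open>The bound of \<open>card_stay_below_ge\<close> holds at every point of the ball; summing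
  it over the ball gives closedness.\<close>

lemma almost_closed_low_ball:
  assumes K: "K \<ge> 1" and m: "sqrt (real m) \<ge> 80 * K"
  shows "almost_closed (F2 (m\<^sup>2)) (root_sphere (m\<^sup>2)) (exp (- 400 * K\<^sup>2) / 4) (low_ball K (m\<^sup>2))"
proof -
  let ?n = "m\<^sup>2" and ?s = "sqrt (real m)"
  let ?A = "supp ?n ` low_ball K ?n"
  have sub: "low_ball K ?n \<subseteq> carrier (F2 ?n)" "root_sphere ?n \<subseteq> carrier (F2 ?n)"
    by (auto simp: low_ball_def root_sphere_def)
  have fin: "finite (low_ball K ?n)" "finite (root_sphere ?n)" using sub finite_carrier_F2 finite_subset by blast+
  have ne: "low_ball K ?n \<noteq> {}"
  proof -
    \<comment> \<open>The zero vector, with empty support, lies in the ball.\<close>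
    have "2 * K * ?s \<le> ?s * ?s" using m K by (intro mult_right_mono) auto
    then have "real m * (2 * K * ?s) \<le> real m * real m" by (intro mult_left_mono) auto
    then have "{} \<in> ?A" unfolding supp_image_low_ball by (simp add: power2_eq_square mult_ac)
    then show ?thesis by blast
  qed
  have "exp (- 400 * K\<^sup>2) / 4 * real (card ?A) * real (card (slice m))
      = (\<Sum>a\<in>?A. exp (- 400 * K\<^sup>2) / 4 * real (card (slice m)))" by simp
  also have "\<dots> \<le> (\<Sum>a\<in>?A. real (card {b \<in> slice m. sd a b \<in> ?A}))"
  proof (rule sum_mono)
    fix a assume a: "a \<in> ?A"
    have "{b \<in> slice m. sd a b \<in> ?A}
        = {b \<in> slice m. real (card (sd a b)) \<le> (real m)\<^sup>2 / 2 - K * real m * ?s}"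
      using a unfolding supp_image_low_ball by (auto simp: slice_def sd_def)
    then show "exp (- 400 * K\<^sup>2) / 4 * real (card (slice m)) \<le> real (card {b \<in> slice m. sd a b \<in> ?A})"
      using card_stay_below_ge[OF K refl m, of a] a unfolding supp_image_low_ball by simp
  qed
  also have "\<dots> = real (card (stay ?A (slice m)))"
    unfolding stay_def using card_pairs[of ?A "slice m" "\<lambda>a b. sd a b \<in> ?A"] fin by simp
  finally have "exp (- 400 * K\<^sup>2) / 4 * real (card (low_ball K ?n)) * real (card (root_sphere ?n))
      \<le> real (card {(a, b) \<in> low_ball K ?n \<times> root_sphere ?n. a \<otimes>\<^bsub>F2 ?n\<^esub> b \<in> low_ball K ?n})"
    unfolding card_closed_pairs_F2[OF sub] supp_image_root_sphere
    unfolding card_supp_image[OF sub(1)]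
    unfolding card_supp_image[OF sub(2), unfolded supp_image_root_sphere] .
  moreover have "root_sphere ?n \<noteq> {}"
    using supp_image_root_sphere[of m] card_slice_pos[of m] by force
  ultimately show ?thesis
    unfolding almost_closed_def using sub fin ne by simp
qed

text \<open>On the ball the signs sum to at least \<open>2 K m * sqrt m\<close>. Adding
  \<open>l\<close> vectors of weight \<open>m\<close> lowers this by at most \<open>2 l m\<close>,
  which for large \<open>m\<close> is at most half of it.\<close>

lemma sum_sg_sumset_low_ball_ge:
  assumes v: "v \<in> sumset_iter (F2 (m\<^sup>2)) (low_ball K (m\<^sup>2)) l (root_sphere (m\<^sup>2))"
    and K: "2 * real l \<le> K * sqrt (real m)"
  shows "v \<in> carrier (F2 (m\<^sup>2))" "(\<Sum>i<m\<^sup>2. sg (supp (m\<^sup>2) v) i) \<ge> K * real m * sqrt (real m)"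
proof -
  let ?n = "m\<^sup>2"
  interpret comm_group "F2 ?n" by (rule comm_group_F2)
  obtain a b where ab: "v = a \<otimes>\<^bsub>F2 ?n\<^esub> finprod (F2 ?n) b {1..l}" "a \<in> low_ball K ?n" "b \<in> {1..l} \<rightarrow> root_sphere ?n"
    using v unfolding sumset_iter_def by blast
  have cl: "a \<in> carrier (F2 ?n)" "b \<in> {1..l} \<rightarrow> carrier (F2 ?n)"
    using ab by (auto simp: low_ball_def root_sphere_def)
  then show vc: "v \<in> carrier (F2 ?n)" using ab by simp
  have "weight ?n (finprod (F2 ?n) b {1..l}) \<le> card {1..l} * m"
  proof (rule weight_finprod_le[OF _ cl(2)])
    fix i assume "i \<in> {1..l}"
    then have "b i \<in> root_sphere ?n" using ab(3) by blast
    then show "weight ?n (b i) \<le> m" unfolding root_sphere_def powr_square by simp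
  qed simp
  then have "weight ?n v \<le> weight ?n a + l * m"
    using weight_mult_le[of a ?n "finprod (F2 ?n) b {1..l}"] cl ab(1) by simp
  then have "real (weight ?n v) \<le> real (weight ?n a) + real l * real m"
    unfolding of_nat_add[symmetric] of_nat_mult[symmetric] of_nat_le_iff .
  moreover have "real (weight ?n a) \<le> (real m)\<^sup>2 / 2 - K * (real m * sqrt (real m))"
    using ab(2) unfolding low_ball_def powr_square by simp
  moreover have "real m * (2 * real l) \<le> real m * (K * sqrt (real m))"
    using K by (intro mult_left_mono) auto
  moreover have "(\<Sum>i<?n. sg (supp ?n v) i) = (real m)\<^sup>2 - 2 * real (weight ?n v)"
    using sum_sg[OF supp_subset] by (simp add: weight_eq_card_supp)
  ultimately have "(\<Sum>i<?n. sg (supp ?n v) i) \<ge> real m * (K * sqrt (real m))"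
    by argo
  then show "(\<Sum>i<?n. sg (supp ?n v) i) \<ge> K * real m * sqrt (real m)"
    by (simp only: mult.commute mult.left_commute)
qed

lemma no_almost_closed_subset:
  assumes K: "K \<ge> 10" and "\<delta> > 0"
  shows "\<exists>M. \<forall>m\<ge>M. \<not> (\<exists>C B'. C \<noteq> {} \<and> C \<subseteq> sumset_iter (F2 (m\<^sup>2)) (low_ball K (m\<^sup>2)) l (root_sphere (m\<^sup>2)) \<and>
    B' \<subseteq> root_sphere (m\<^sup>2) \<and> real (card B') \<ge> \<delta> * real (card (root_sphere (m\<^sup>2))) \<and>
    almost_closed (F2 (m\<^sup>2)) B' (99 / 100) C)"
proof -
  obtain M where M: "\<forall>m\<ge>M. \<forall>C B. C \<subseteq> Pow {..<m\<^sup>2} \<longrightarrow> C \<noteq> {} \<longrightarrow>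
    (\<forall>x\<in>C. (\<Sum>i<m\<^sup>2. sg x i) \<ge> K * real m * sqrt (real m)) \<longrightarrow>
    B \<subseteq> slice m \<longrightarrow> real (card B) \<ge> \<delta> * real (card (slice m)) \<longrightarrow>
    real (card (stay C B)) < 99 / 100 * real (card C) * real (card B)"
    using card_stay_less[OF assms] by (elim exE)
  have "\<forall>\<^sub>F m in sequentially. 2 * real l \<le> K * sqrt (real m)"
    using K by real_asymp
  then obtain M' where M': "\<And>m. m \<ge> M' \<Longrightarrow> 2 * real l \<le> K * sqrt (real m)"
    unfolding eventually_sequentially by blast
  show ?thesis
  proof (intro exI[of _ "max M M'"] allI impI notI, elim exE conjE)
    fix m C B'
    assume m: "max M M' \<le> m" and C: "C \<noteq> {}" "C \<subseteq> sumset_iter (F2 (m\<^sup>2)) (low_ball K (m\<^sup>2)) l (root_sphere (m\<^sup>2))"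
      and B': "B' \<subseteq> root_sphere (m\<^sup>2)" "real (card B') \<ge> \<delta> * real (card (root_sphere (m\<^sup>2)))"
      and cl: "almost_closed (F2 (m\<^sup>2)) B' (99 / 100) C"
    let ?n = "m\<^sup>2"
    have sub: "C \<subseteq> carrier (F2 ?n)" "B' \<subseteq> carrier (F2 ?n)" using cl by (auto simp: almost_closed_def)
    have sph: "card (root_sphere ?n) = card (slice m)"
      using card_supp_image[of "root_sphere ?n" ?n] supp_image_root_sphere[of m] by (auto simp: root_sphere_def)
    have "real (card (stay (supp ?n ` C) (supp ?n ` B')))
        < 99 / 100 * real (card (supp ?n ` C)) * real (card (supp ?n ` B'))"
    proof (rule M[rule_format])
      show "supp ?n ` C \<subseteq> Pow {..<?n}" using supp_subset by auto
      fix x assume "x \<in> supp ?n ` C"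
      then obtain v where v: "v \<in> C" "x = supp ?n v" by blast
      show "(\<Sum>i<?n. sg x i) \<ge> K * real m * sqrt (real m)"
        unfolding v(2) by (rule sum_sg_sumset_low_ball_ge(2)[OF subsetD[OF C(2) v(1)] M']) (use m in simp)
    next
      show "supp ?n ` B' \<subseteq> slice m" using B'(1) supp_image_root_sphere[of m] by blast
      show "real (card (supp ?n ` B')) \<ge> \<delta> * real (card (slice m))"
        unfolding card_supp_image[OF sub(2)] using B'(2) sph by simp
    qed (use m C in auto)
    then have "real (card {(a, b) \<in> C \<times> B'. a \<otimes>\<^bsub>F2 ?n\<^esub> b \<in> C}) < 99 / 100 * real (card C) * real (card B')"
      unfolding card_closed_pairs_F2[OF sub] card_supp_image[OF sub(1)] card_supp_image[OF sub(2)] .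
    then show False using cl unfolding almost_closed_def by linarith
  qed
qed

section \<open>Failure of the closed subset property\<close>

text \<open>Carries the example to a group on the naturals, and the sets obtained there back
  again.\<close>

lemma almost_closed_hom_image:
  assumes "group G" and h: "h \<in> hom G H" "inj_on h (carrier G)" and "almost_closed G B \<eta> A"
  shows "almost_closed H (h ` B) \<eta> (h ` A)"
proof -
  interpret group G by fact
  have ac: "A \<subseteq> carrier G" "finite A" "A \<noteq> {}" "B \<subseteq> carrier G" "finite B" "B \<noteq> {}"
    "real (card {(a, b) \<in> A \<times> B. a \<otimes>\<^bsub>G\<^esub> b \<in> A}) \<ge> \<eta> * real (card A) * real (card B)"
    using assms(4) by (auto simp: almost_closed_def)
  have "card {(x, y) \<in> h ` A \<times> h ` B. x \<otimes>\<^bsub>H\<^esub> y \<in> h ` A} = card {(a, b) \<in> A \<times> B. a \<otimes>\<^bsub>G\<^esub> b \<in> A}"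
  proof (rule card_closed_pairs_image[OF h(2) ac(1,4)])
    fix a b assume "a \<in> A" "b \<in> B"
    then have "a \<in> carrier G" "b \<in> carrier G" using ac by auto
    then show "a \<otimes>\<^bsub>G\<^esub> b \<in> carrier G \<and> h (a \<otimes>\<^bsub>G\<^esub> b) = h a \<otimes>\<^bsub>H\<^esub> h b"
      using h(1) by (simp add: hom_mult)
  qed
  moreover have "card (h ` A) = card A" "card (h ` B) = card B"
    using ac h(2) by (auto intro: card_image inj_on_subset)
  moreover have "h ` A \<subseteq> carrier H" "h ` B \<subseteq> carrier H"
    using ac h(1) by (auto simp: hom_def)
  ultimately show ?thesis
    unfolding almost_closed_def using ac by simp
qed

lemma hom_finprod_comm_group:
  assumes "comm_group G" "comm_group H" "h \<in> hom G H" "finite I" "f \<in> I \<rightarrow> carrier G"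
  shows "h (finprod G f I) = finprod H (h \<circ> f) I"
proof -
  interpret G: comm_group G by fact
  interpret H: comm_group H by fact
  interpret group_hom G H h by unfold_locales fact
  show ?thesis
    using assms(4,5)
  proof (induction I rule: finite_induct)
    case (insert i I)
    then have f: "f i \<in> carrier G" "f \<in> I \<rightarrow> carrier G" by auto
    then have hf: "h \<circ> f \<in> I \<rightarrow> carrier H" "(h \<circ> f) i \<in> carrier H" by (auto simp: Pi_iff)
    have "h (finprod G f (insert i I)) = h (f i) \<otimes>\<^bsub>H\<^esub> h (finprod G f I)"
      using insert.hyps f by simp
    then show ?case
      unfolding H.finprod_insert[OF insert.hyps hf] insert.IH[OF f(2)] by simp
  qed simp
qed

lemma hom_sumset_iter:
  assumes "comm_group G" "comm_group H" "h \<in> hom G H" and AB: "A \<subseteq> carrier G" "B \<subseteq> carrier G"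
    and x: "x \<in> sumset_iter G A l B"
  shows "h x \<in> sumset_iter H (h ` A) l (h ` B)"
proof -
  interpret G: comm_group G by fact
  obtain a b where ab: "x = a \<otimes>\<^bsub>G\<^esub> finprod G b {1..l}" "a \<in> A" "b \<in> {1..l} \<rightarrow> B"
    using x unfolding sumset_iter_def by blast
  then have cl: "a \<in> carrier G" "b \<in> {1..l} \<rightarrow> carrier G" using AB by auto
  have "h x = h a \<otimes>\<^bsub>H\<^esub> finprod H (h \<circ> b) {1..l}"
    unfolding ab(1) hom_mult[OF assms(3) cl(1) G.finprod_closed[OF cl(2)]]
    using hom_finprod_comm_group[OF assms(1-3) _ cl(2)] by simp
  moreover have "h a \<in> h ` A" "h \<circ> b \<in> {1..l} \<rightarrow> h ` B" using ab by auto
  ultimately show ?thesis unfolding sumset_iter_def by blast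
qed

text \<open>Some outcome of the walk ends at a point \<open>a = x - y + z\<close> of
  \<open>A\<close>, where \<open>y\<close> and \<open>z\<close> are the sums of its two halves. Then
  \<open>a + y + z = x + 2 z = x\<close> in exponent 2, so \<open>x\<close> is \<open>a\<close> plus
  the \<open>2 * l\<close> steps.\<close>

lemma mem_sumset_iter_if_walk_prob_pos:
  assumes "comm_group G" and sq: "\<And>u. u \<in> carrier G \<Longrightarrow> u \<otimes>\<^bsub>G\<^esub> u = \<one>\<^bsub>G\<^esub>"
    and A: "A \<subseteq> carrier G" and B: "B \<subseteq> carrier G" "finite B" "B \<noteq> {}"
    and x: "x \<in> carrier G" and pos: "walk_prob G A B l x > 0"
  shows "x \<in> sumset_iter G A (2 * l) B"
proof -
  interpret comm_group G by fact
  let ?p = "Pi_pmf {1..2 * l} undefined (\<lambda>_. pmf_of_set B)"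
  let ?E = "{b. x \<otimes>\<^bsub>G\<^esub> inv\<^bsub>G\<^esub> (finprod G b {1..l}) \<otimes>\<^bsub>G\<^esub> finprod G b {l+1..2 * l} \<in> A}"
  have "set_pmf ?p \<inter> ?E \<noteq> {}"
    using pos unfolding walk_prob_def measure_pmf_zero_iff[symmetric] by simp
  then obtain b where b: "b \<in> set_pmf ?p" "b \<in> ?E" by blast
  have bB: "b i \<in> B" if "i \<in> {1..2 * l}" for i
  proof -
    have "b \<in> PiE_dflt {1..2 * l} undefined (\<lambda>_. B)"
      using b(1) set_Pi_pmf[of "{1..2 * l}" undefined "\<lambda>_. pmf_of_set B"] B by (simp add: comp_def)
    then show ?thesis using that unfolding PiE_dflt_def by blast
  qed
  let ?y = "finprod G b {1..l}" and ?z = "finprod G b {l+1..2 * l}"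
  have cl: "b \<in> {1..l} \<rightarrow> carrier G" "b \<in> {l+1..2 * l} \<rightarrow> carrier G"
    using bB B(1) by auto
  then have yz: "?y \<in> carrier G" "?z \<in> carrier G" by auto
  define a where "a = x \<otimes>\<^bsub>G\<^esub> inv\<^bsub>G\<^esub> ?y \<otimes>\<^bsub>G\<^esub> ?z"
  have "finprod G b {1..2 * l} = ?y \<otimes>\<^bsub>G\<^esub> ?z"
  proof -
    have "{1..2 * l} = {1..l} \<union> {l+1..2 * l}" by auto
    then show ?thesis using cl by (simp only:) (rule finprod_Un_disjoint, auto)
  qed
  also have "\<dots> = ?z \<otimes>\<^bsub>G\<^esub> ?y" using yz by (rule m_comm)
  finally have "a \<otimes>\<^bsub>G\<^esub> finprod G b {1..2 * l} = x \<otimes>\<^bsub>G\<^esub> (inv\<^bsub>G\<^esub> ?y \<otimes>\<^bsub>G\<^esub> ((?z \<otimes>\<^bsub>G\<^esub> ?z) \<otimes>\<^bsub>G\<^esub> ?y))"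
    using x yz by (simp add: a_def m_assoc)
  also have "\<dots> = x" using x yz sq by simp
  finally have "x = a \<otimes>\<^bsub>G\<^esub> finprod G b {1..2 * l}" by simp
  moreover have "a \<in> A" using b(2) by (simp add: a_def)
  moreover have "b \<in> {1..2 * l} \<rightarrow> B" using bB by auto
  ultimately show ?thesis unfolding sumset_iter_def by blast
qed

text \<open>Transports the operation along an enumeration of the carrier; needed because
  \<open>closed_subset_property\<close> ranges over groups of naturals.\<close>

lemma exists_nat_comm_group_iso:
  assumes "comm_group G" "finite (carrier G)"
  shows "\<exists>(H :: nat monoid) h. comm_group H \<and> h \<in> iso G H"
proof -
  interpret comm_group G by fact
  obtain h where h: "bij_betw h (carrier G) {0..<card (carrier G)}"
    using ex_bij_betw_finite_nat[OF assms(2)] by blast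
  define g where "g = inv_into (carrier G) h"
  define H where "H = \<lparr>carrier = {0..<card (carrier G)}, monoid.mult = (\<lambda>x y. h (g x \<otimes>\<^bsub>G\<^esub> g y)), one = h \<one>\<^bsub>G\<^esub>\<rparr>"
  have g: "g x \<in> carrier G" "h (g x) = x" if "x \<in> {0..<card (carrier G)}" for x
    using that h unfolding g_def by (auto simp: bij_betw_def inv_into_into f_inv_into_f)
  have gh: "g (h x) = x" "h x \<in> {0..<card (carrier G)}" if "x \<in> carrier G" for x
    using that h unfolding g_def by (auto simp: bij_betw_def)
  have iso: "h \<in> iso G H"
    using h gh by (auto simp: iso_def hom_def H_def)
  moreover have "monoid H"
    by (rule monoidI) (auto simp: H_def gh g m_assoc simp del: atLeastLessThan_iff)
  ultimately have "comm_group H"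
    using iso_imp_comm_group[of H] by (auto simp: is_iso_def)
  with iso show ?thesis by blast
qed

text \<open>The property, applied with \<open>\<epsilon> = 1 / 100\<close> to a copy of the vector
  group on the naturals, would yield sets \<open>C\<close> and \<open>B'\<close> whose preimages
  contradict \<open>none\<close>.\<close>

lemma not_closed_subset_property:
  fixes \<eta> :: real and A B :: "nat \<Rightarrow> (nat \<Rightarrow> int) set"
  assumes \<eta>: "\<eta> > 0"
    and closed: "\<exists>M. \<forall>m\<ge>M. almost_closed (F2 (m\<^sup>2)) (B m) \<eta> (A m)"
    and none: "\<And>\<delta> l. \<delta> > 0 \<Longrightarrow> \<exists>M. \<forall>m\<ge>M. \<not> (\<exists>C B'. C \<noteq> {} \<and>
      C \<subseteq> sumset_iter (F2 (m\<^sup>2)) (A m) l (B m) \<and> B' \<subseteq> B m \<and>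
      real (card B') \<ge> \<delta> * real (card (B m)) \<and> almost_closed (F2 (m\<^sup>2)) B' (99 / 100) C)"
  shows "\<not> closed_subset_property"
proof
  assume csp: closed_subset_property
  have pos: "(1 / 100 :: real) > 0" by simp
  obtain c \<delta> :: real and l :: nat where c: "c > 0" and \<delta>: "\<delta> > 0"
    and ex: "\<forall>(G :: nat monoid) A B. comm_group G \<and> finite (carrier G) \<and> almost_closed G B \<eta> A \<longrightarrow>
      (\<exists>B' C. B' \<subseteq> B \<and> C \<subseteq> carrier G \<and> C \<noteq> {} \<and> real (card B') \<ge> \<delta> * real (card B) \<and>
        almost_closed G B' (1 - 1 / 100) C \<and> (\<forall>x\<in>C. walk_prob G A B l x \<ge> c))"
    using csp[unfolded closed_subset_property_def, THEN spec, THEN mp, OF \<eta>, THEN spec, THEN mp, OF pos]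
    by (elim exE conjE)
  obtain M1 where M1: "\<And>m. m \<ge> M1 \<Longrightarrow> almost_closed (F2 (m\<^sup>2)) (B m) \<eta> (A m)"
    using closed by blast
  obtain M2 where M2: "\<And>m. m \<ge> M2 \<Longrightarrow> \<not> (\<exists>C B'. C \<noteq> {} \<and>
      C \<subseteq> sumset_iter (F2 (m\<^sup>2)) (A m) (2 * l) (B m) \<and> B' \<subseteq> B m \<and>
      real (card B') \<ge> \<delta> * real (card (B m)) \<and> almost_closed (F2 (m\<^sup>2)) B' (99 / 100) C)"
    \<comment> \<open>The number of summands is doubled because the walk takes \<open>2 * l\<close>
      steps.\<close>
    using none[OF \<delta>, of "2 * l"] by blast
  define m where "m = max M1 M2"
  let ?F = "F2 (m\<^sup>2)"
  interpret F: comm_group ?F by (rule comm_group_F2)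
  have cl: "almost_closed ?F (B m) \<eta> (A m)" using M1 by (simp add: m_def)
  then have AB: "A m \<subseteq> carrier ?F" "B m \<subseteq> carrier ?F" "finite (B m)" "B m \<noteq> {}"
    by (auto simp: almost_closed_def)
  obtain G :: "nat monoid" and h where G: "comm_group G" and h: "h \<in> iso ?F G"
    using exists_nat_comm_group_iso[OF comm_group_F2 finite_carrier_F2] by blast
  interpret G: comm_group G by fact
  \<comment> \<open>The inverse isomorphism brings \<open>C\<close> and \<open>B'\<close> back to
    vectors.\<close>
  define g where "g = inv_into (carrier ?F) h"
  have g: "g \<in> iso G ?F" using h F.iso_set_sym unfolding g_def by blast
  have hom: "h \<in> hom ?F G" "inj_on h (carrier ?F)" "g \<in> hom G ?F" "inj_on g (carrier G)"
    using h g by (auto simp: iso_def bij_betw_def)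
  have carG: "h ` carrier ?F = carrier G" using h by (auto simp: iso_def bij_betw_def)
  have gh: "g (h x) = x" if "x \<in> carrier ?F" for x
    using that hom(2) by (simp add: g_def)
  have ghS: "g ` h ` S = S" if "S \<subseteq> carrier ?F" for S
  proof -
    have "(\<lambda>x. g (h x)) ` S = (\<lambda>x. x) ` S" using that gh by (intro image_cong) auto
    then show ?thesis by (simp add: image_image)
  qed
  have finG: "finite (carrier G)" unfolding carG[symmetric] by simp
  have sqG: "u \<otimes>\<^bsub>G\<^esub> u = \<one>\<^bsub>G\<^esub>" if u: "u \<in> carrier G" for u
  proof -
    obtain v where v: "v \<in> carrier ?F" "u = h v" using u carG by blast
    have "u \<otimes>\<^bsub>G\<^esub> u = h (v \<otimes>\<^bsub>?F\<^esub> v)" using v hom(1) by (simp add: hom_mult)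
    also have "\<dots> = h \<one>\<^bsub>?F\<^esub>" using mult_self_F2[OF v(1)] by simp
    also have "\<dots> = \<one>\<^bsub>G\<^esub>" by (rule hom_one[OF hom(1) F.is_group G.is_group])
    finally show ?thesis .
  qed
  have "almost_closed G (h ` B m) \<eta> (h ` A m)"
    by (rule almost_closed_hom_image[OF F.is_group hom(1,2) cl])
  then obtain B' C where B': "B' \<subseteq> h ` B m" and C: "C \<subseteq> carrier G" "C \<noteq> {}"
    and dense: "real (card B') \<ge> \<delta> * real (card (h ` B m))"
    and clC: "almost_closed G B' (1 - 1 / 100) C" and walk: "\<And>x. x \<in> C \<Longrightarrow> walk_prob G (h ` A m) (h ` B m) l x \<ge> c"
    using ex G finG by meson
  have sub: "h ` A m \<subseteq> carrier G" "h ` B m \<subseteq> carrier G" using AB carG by auto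
  have "g ` C \<subseteq> sumset_iter ?F (A m) (2 * l) (B m)"
  proof (intro image_subsetI)
    fix x assume x: "x \<in> C"
    have "x \<in> sumset_iter G (h ` A m) (2 * l) (h ` B m)"
      by (rule mem_sumset_iter_if_walk_prob_pos[OF G sqG sub]) (use AB C x walk[OF x] c in auto)
    then have "g x \<in> sumset_iter ?F (g ` h ` A m) (2 * l) (g ` h ` B m)"
      by (rule hom_sumset_iter[OF G comm_group_F2 hom(3) sub])
    then show "g x \<in> sumset_iter ?F (A m) (2 * l) (B m)" unfolding ghS[OF AB(1)] ghS[OF AB(2)] .
  qed
  moreover have "g ` B' \<subseteq> B m" using B' ghS[OF AB(2)] by blast
  moreover have "real (card (g ` B')) \<ge> \<delta> * real (card (B m))"
  proof -
    have "card (g ` B') = card B'"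
      using B' sub(2) hom(4) by (intro card_image) (blast intro: inj_on_subset)
    moreover have "card (h ` B m) = card (B m)"
      using AB(2) hom(2) by (intro card_image) (blast intro: inj_on_subset)
    ultimately show ?thesis using dense by simp
  qed
  moreover have "almost_closed ?F (g ` B') (99 / 100) (g ` C)"
    using almost_closed_hom_image[OF G.is_group hom(3,4) clC] by simp
  moreover have "g ` C \<noteq> {}" using C by simp
  ultimately have "\<exists>C B'. C \<noteq> {} \<and> C \<subseteq> sumset_iter ?F (A m) (2 * l) (B m) \<and> B' \<subseteq> B m \<and>
      real (card B') \<ge> \<delta> * real (card (B m)) \<and> almost_closed ?F B' (99 / 100) C"
    by (intro exI[of _ "g ` C"] exI[of _ "g ` B'"] conjI)
  moreover have "m \<ge> M2" by (simp add: m_def)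
  ultimately show False by (rule notE[OF M2, rotated])
qed

section \<open>Choice of the absolute constant and assembly of both statements\<close>

theorem mainTheorem4:
  shows
    "(\<exists>\<eta>::real. \<eta> > 0 \<and>
        (\<forall>\<delta>>0. \<forall>l::nat. l > 0 \<longrightarrow>
          (\<exists>N. \<forall>n\<ge>N. (\<exists>m. n = m ^ 2) \<longrightarrow>
            (let A = {v \<in> carrier (F2 n). real (weight n v) \<le> real n / 2 - 10 ^ 20 * real n powr (3 / 4)};
                 B = {v \<in> carrier (F2 n). real (weight n v) = real n powr (1 / 2)}
             in almost_closed (F2 n) B \<eta> A \<and>
                \<not> (\<exists>C B'. C \<noteq> {} \<and> C \<subseteq> sumset_iter (F2 n) A l B \<and>
                      B' \<subseteq> B \<and> real (card B') \<ge> \<delta> * real (card B) \<and>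
                      almost_closed (F2 n) B' 0.99 C)))))
     \<and> \<not> closed_subset_property"
proof -
  obtain K :: real where K: "K = 10 ^ 20" by blast
  then have K10: "K \<ge> 10" by simp
  \<comment> \<open>This depends on \<open>K\<close> alone, so it is fixed before
    \<open>\<delta>\<close> and \<open>l\<close>.\<close>
  define \<eta> where "\<eta> = exp (- 400 * K\<^sup>2) / 4"
  have \<eta>: "\<eta> > 0" by (simp add: \<eta>_def)
  have "\<forall>\<^sub>F m in sequentially. sqrt (real m) \<ge> 80 * K" by real_asymp
  then have closed: "\<exists>M. \<forall>m\<ge>M. almost_closed (F2 (m\<^sup>2)) (root_sphere (m\<^sup>2)) \<eta> (low_ball K (m\<^sup>2))"
    unfolding eventually_sequentially \<eta>_def using almost_closed_low_ball K10 by fastforce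
  note none = no_almost_closed_subset[OF K10]
  have main: "\<exists>N. \<forall>n\<ge>N. (\<exists>m. n = m ^ 2) \<longrightarrow> almost_closed (F2 n) (root_sphere n) \<eta> (low_ball K n) \<and>
      \<not> (\<exists>C B'. C \<noteq> {} \<and> C \<subseteq> sumset_iter (F2 n) (low_ball K n) l (root_sphere n) \<and>
        B' \<subseteq> root_sphere n \<and> real (card B') \<ge> \<delta> * real (card (root_sphere n)) \<and> almost_closed (F2 n) B' (99 / 100) C)"
    if \<delta>: "\<delta> > 0" for \<delta> :: real and l
  proof -
    obtain M1 where M1: "\<And>m. m \<ge> M1 \<Longrightarrow> almost_closed (F2 (m\<^sup>2)) (root_sphere (m\<^sup>2)) \<eta> (low_ball K (m\<^sup>2))"
      using closed by blast
    obtain M2 where M2: "\<And>m. m \<ge> M2 \<Longrightarrow>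
      \<not> (\<exists>C B'. C \<noteq> {} \<and> C \<subseteq> sumset_iter (F2 (m\<^sup>2)) (low_ball K (m\<^sup>2)) l (root_sphere (m\<^sup>2)) \<and>
        B' \<subseteq> root_sphere (m\<^sup>2) \<and> real (card B') \<ge> \<delta> * real (card (root_sphere (m\<^sup>2))) \<and>
        almost_closed (F2 (m\<^sup>2)) B' (99 / 100) C)"
      using none[OF \<delta>] by blast
    show ?thesis
    \<comment> \<open>Squaring converts a threshold for \<open>m\<close> into one for
      \<open>n = m^2\<close>.\<close>
    proof (intro exI[of _ "(max M1 M2)\<^sup>2"] allI impI, elim exE)
      fix n m assume n: "(max M1 M2)\<^sup>2 \<le> n" "n = m\<^sup>2"
      then have "max M1 M2 \<le> m" using power2_nat_le_eq_le by simp
      then show "almost_closed (F2 n) (root_sphere n) \<eta> (low_ball K n) \<and>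
        \<not> (\<exists>C B'. C \<noteq> {} \<and> C \<subseteq> sumset_iter (F2 n) (low_ball K n) l (root_sphere n) \<and>
        B' \<subseteq> root_sphere n \<and> real (card B') \<ge> \<delta> * real (card (root_sphere n)) \<and> almost_closed (F2 n) B' (99 / 100) C)"
        unfolding n(2) by (intro conjI M1 M2) auto
    qed
  qed
  have "(0.99::real) = 99 / 100" by simp
  note unfolds = Let_def low_ball_def[symmetric] root_sphere_def[symmetric] K[symmetric] this
  have first: "\<forall>\<delta>>0. \<forall>l::nat. l > 0 \<longrightarrow>
          (\<exists>N. \<forall>n\<ge>N. (\<exists>m. n = m ^ 2) \<longrightarrow>
            (let A = {v \<in> carrier (F2 n). real (weight n v) \<le> real n / 2 - 10 ^ 20 * real n powr (3 / 4)};
                 B = {v \<in> carrier (F2 n). real (weight n v) = real n powr (1 / 2)}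
             in almost_closed (F2 n) B \<eta> A \<and>
                \<not> (\<exists>C B'. C \<noteq> {} \<and> C \<subseteq> sumset_iter (F2 n) A l B \<and>
                      B' \<subseteq> B \<and> real (card B') \<ge> \<delta> * real (card B) \<and>
                      almost_closed (F2 n) B' 0.99 C)))"
    unfolding unfolds by (intro allI impI, rule main)
  show ?thesis
    by (rule conjI[OF exI[of _ \<eta>] not_closed_subset_property[OF \<eta> closed none]], rule conjI[OF \<eta> first])
qed

end
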